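(* Let $(M,g,J)$ be a Hermitian manifold with fundamental form $\omega_g$, and let $\gamma:[a,b]\to M$ be a unit speed geodesic. Let $\alpha:[a,b]\times(-\varepsilon_1,\varepsilon_1)\times(-\varepsilon_2,\varepsilon_2)\to M$ be a smooth variation of $\gamma$ with variational vector fields $V$ and $W$, i.e. $\alpha(t,0,0)=\gamma(t)$, $\alpha_*\left(\frac{\partial}{\partial s_1}\right)\big|_{s_1=s_2=0}=V$ and $\alpha_*\left(\frac{\partial}{\partial s_2}\right)\big|_{s_1=s_2=0}=W$. Then the second variation of the energy of $\gamma$ is $$\frac{\partial^2 E(\alpha)}{\partial s_1\partial s_2}\bigg|_{s_1=s_2=0}=\int_a^b\left\{\left\langle\hat{\nabla}^{\mathrm{SB}}_{\frac{d}{dt}}V,\hat{\nabla}^{\mathrm{SB}}_{\frac{d}{dt}}W\right\rangle+T^{\mathrm{SB}}\left(V,\gamma',\hat{\nabla}^{\mathrm{SB}}_{\frac{d}{dt}}W\right)-R^{\mathrm{SB}}(V,\gamma',\gamma',W)\right\}dt+\left.\left\langle\left.\left(\overline{\nabla}^{\mathrm{SB}}_{\frac{\partial}{\partial s_1}}\alpha_*\left(\frac{\partial}{\partial s_2}\right)\right)\right|_{s_1=s_2=0},\gamma'\right\rangle\right|_{t=a}^{t=b}.$$ Moreover, if $\alpha$ is a proper variation of $\gamma$ (i.e. $\alpha(a,s_1,s_2)\equiv\gamma(a)$ and $\alpha(b,s_1,s_2)\equiv\gamma(b)$), then $$\frac{\partial^2 E(\alpha)}{\partial s_1\partial s_2}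\bigg|_{s_1=s_2=0}=\int_a^b\left\{\left\langle\hat{\nabla}^{\mathrm{SB}}_{\frac{d}{dt}}V,\hat{\nabla}^{\mathrm{SB}}_{\frac{d}{dt}}W\right\rangle+T^{\mathrm{SB}}\left(V,\gamma',\hat{\nabla}^{\mathrm{SB}}_{\frac{d}{dt}}W\right)-R^{\mathrm{SB}}(V,\gamma',\gamma',W)\right\}dt.$$
   Context: A Hermitian manifold $(M,g,J)$ is a manifold with a Riemannian metric $g=\langle\cdot,\cdot\rangle$ and an integrable complex structure $J$ with $g(JX,JY)=g(X,Y)$. Its fundamental form is $\omega_g(X,Y)=g(JX,Y)$ for real tangent vectors $X,Y$. $\nabla^{\mathrm{LC}}$ is the Levi-Civita connection of $g$; geodesics are those of $\nabla^{\mathrm{LC}}$ (they coincide with those of $\nabla^{\mathrm{SB}}$ below). The Strominger-Bismut connection $\nabla^{\mathrm{SB}}$ on the real tangent bundle is the affine connection defined by $$g(\nabla_X^{\mathrm{SB}}Y,Z)=g(\nabla_X^{\mathrm{LC}}Y,Z)+\tfrac12(d\omega_g)(JX,JY,JZ);$$ it is the unique affine connection compatible with $g$ and $J$ whose torsion $T^{\mathrm{SB}}(X,Y,Z):=g(\nabla^{\mathrm{SB}}_XY-\nabla^{\mathrm{SB}}_YX-[X,Y],Z)$ is totally skew-symmetric. Its curvature tensor is $$R^{\mathrm{SB}}(X,Y,Z,W)=\left\langle\nabla^{\mathrm{SB}}_X\nabla^{\mathrm{SB}}_YZ-\nabla^{\mathrm{SB}}_Y\nabla^{\mathrm{SB}}_XZ-\nabla^{\mathrm{SB}}_{[X,Y]}Z,W\right\rangle.$$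 The energy of a curve $c:[a,b]\to M$ is $E(c)=\frac12\int_a^b|c'(t)|^2dt$, and $E(\alpha)$ denotes the function $(s_1,s_2)\mapsto E(\alpha(\bullet,s_1,s_2))$. $\hat\nabla^{\mathrm{SB}}$ and $\overline\nabla^{\mathrm{SB}}$ denote the connections induced by $\nabla^{\mathrm{SB}}$ on the pullback bundles $\gamma^*TM$ and $\alpha^*TM$ respectively. *)

theory Defs
  imports "HOL-Analysis.Analysis"
begin

section \<open>Smooth maps between Euclidean spaces\<close>

text \<open>
  Derivatives are taken within \<open>S\<close>.  For open \<open>S\<close> this is the usual notion; for relatively open
  subsets of boxes such as \<open>{a..b} \<times> {-e<..<e}\<close> the derivatives at boundary points are one-sided
  (and still unique), which is smoothness up to the boundary.
\<close>

primrec Ck_on :: "nat \<Rightarrow> 'a::euclidean_space set \<Rightarrow> ('a \<Rightarrow> 'b::euclidean_space) \<Rightarrow> bool" where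
  "Ck_on 0 S f \<longleftrightarrow> continuous_on S f"
| "Ck_on (Suc k) S f \<longleftrightarrow>
     (\<exists>f'. (\<forall>x\<in>S. (f has_derivative f' x) (at x within S)) \<and> (\<forall>v. Ck_on k S (\<lambda>x. f' x v)))"

definition smooth_on :: "'a::euclidean_space set \<Rightarrow> ('a \<Rightarrow> 'b::euclidean_space) \<Rightarrow> bool" where
  "smooth_on S f \<longleftrightarrow> (\<forall>k. Ck_on k S f)"


section \<open>Smooth manifolds and their tangent spaces\<close>

text \<open>
  The manifold is the whole type \<open>'m\<close>, modelled on the Euclidean space \<open>'e\<close> by an atlas.
  A chart is a pair of its domain and its coordinate map.
\<close>

type_synonym ('m, 'e) chart = "'m set \<times> ('m \<Rightarrow> 'e)"

definition chart_inv :: "('m, 'e) chart \<Rightarrow> 'e \<Rightarrow> 'm" where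
  "chart_inv c = inv_into (fst c) (snd c)"

definition transition :: "('m, 'e) chart \<Rightarrow> ('m, 'e) chart \<Rightarrow> 'e \<Rightarrow> 'e" where
  "transition c d = snd d \<circ> chart_inv c"

definition is_chart :: "('m::topological_space, 'e::euclidean_space) chart \<Rightarrow> bool" where
  "is_chart c \<longleftrightarrow> open (fst c) \<and> open (snd c ` fst c) \<and>
     homeomorphism (fst c) (snd c ` fst c) (snd c) (chart_inv c)"

definition smooth_atlas ::
  "('m::{t2_space, second_countable_topology}, 'e::euclidean_space) chart set \<Rightarrow> bool" where
  "smooth_atlas A \<longleftrightarrow> (\<forall>c\<in>A. is_chart c) \<and> (\<Union>c\<in>A. fst c) = UNIV \<and>
     (\<forall>c\<in>A. \<forall>d\<in>A. smooth_on (snd c ` (fst c \<inter> fst d)) (transition c d))"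

text \<open>
  Every tangent space \<open>T\<^sub>pM\<close> is identified with \<open>'e\<close> through one chart \<open>chart_at A p\<close> around \<open>p\<close>,
  chosen once and for all: a vector \<open>v :: 'e\<close> at \<open>p\<close> stands for the class of \<open>(chart_at A p, v)\<close>.
  The components of the same tangent vector in any other chart \<open>c\<close> are \<open>tcoord A c p v\<close>, and
  \<open>tvec A c p u\<close> is the tangent vector at \<open>p\<close> whose components in \<open>c\<close> are \<open>u\<close>.  In particular,
  \<open>tvec A c p b\<close> for \<open>b \<in> Basis\<close> are the coordinate vectors of \<open>c\<close> at \<open>p\<close>.
\<close>

definition chart_at :: "('m, 'e) chart set \<Rightarrow> 'm \<Rightarrow> ('m, 'e) chart" where
  "chart_at A p = (SOME c. c \<in> A \<and> p \<in> fst c)"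

definition tcoord ::
  "('m, 'e::euclidean_space) chart set \<Rightarrow> ('m, 'e) chart \<Rightarrow> 'm \<Rightarrow> 'e \<Rightarrow> 'e" where
  "tcoord A c p v =
     frechet_derivative (transition (chart_at A p) c) (at (snd (chart_at A p) p)) v"

definition tvec ::
  "('m, 'e::euclidean_space) chart set \<Rightarrow> ('m, 'e) chart \<Rightarrow> 'm \<Rightarrow> 'e \<Rightarrow> 'e" where
  "tvec A c p u = frechet_derivative (transition c (chart_at A p)) (at (snd c p)) u"

text \<open>
  Functions and vector fields are total; only their restriction to a neighbourhood of the point
  under consideration matters.  \<open>smooth_near\<close> and \<open>vector_field_near\<close> say that they are smooth on
  some open neighbourhood of \<open>p\<close>.
\<close>

definition smooth_near ::
  "('m::topological_space, 'e::euclidean_space) chart set \<Rightarrow> 'm \<Rightarrow> ('m \<Rightarrow> real) \<Rightarrow> bool" where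
  "smooth_near A p f \<longleftrightarrow> (\<exists>U. open U \<and> p \<in> U \<and>
     (\<forall>c\<in>A. smooth_on (snd c ` (fst c \<inter> U)) (\<lambda>x. f (chart_inv c x))))"

definition field_coord ::
  "('m, 'e::euclidean_space) chart set \<Rightarrow> ('m, 'e) chart \<Rightarrow> ('m \<Rightarrow> 'e) \<Rightarrow> 'e \<Rightarrow> 'e" where
  "field_coord A c X x = tcoord A c (chart_inv c x) (X (chart_inv c x))"

definition vector_field_near ::
  "('m::topological_space, 'e::euclidean_space) chart set \<Rightarrow> 'm \<Rightarrow> ('m \<Rightarrow> 'e) \<Rightarrow> bool" where
  "vector_field_near A p X \<longleftrightarrow> (\<exists>U. open U \<and> p \<in> U \<and>
     (\<forall>c\<in>A. smooth_on (snd c ` (fst c \<inter> U)) (field_coord A c X)))"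

text \<open>\<open>dir_deriv A p v f\<close> is the derivative \<open>v(f)\<close> of \<open>f\<close> along \<open>v \<in> T\<^sub>pM\<close>.\<close>

definition dir_deriv ::
  "('m, 'e::euclidean_space) chart set \<Rightarrow> 'm \<Rightarrow> 'e \<Rightarrow> ('m \<Rightarrow> real) \<Rightarrow> real" where
  "dir_deriv A p v f =
     frechet_derivative (\<lambda>x. f (chart_inv (chart_at A p) x)) (at (snd (chart_at A p) p)) v"

text \<open>
  The Lie bracket \<open>[X,Y]\<close> at \<open>p\<close>, by the coordinate formula \<open>X\<^sup>i \<partial>\<^sub>i Y\<^sup>k - Y\<^sup>i \<partial>\<^sub>i X\<^sup>k\<close> in the chart
  that represents \<open>T\<^sub>pM\<close>.
\<close>

definition lie_bracket ::
  "('m, 'e::euclidean_space) chart set \<Rightarrow> ('m \<Rightarrow> 'e) \<Rightarrow> ('m \<Rightarrow> 'e) \<Rightarrow> 'm \<Rightarrow> 'e" where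
  "lie_bracket A X Y p = (let c = chart_at A p in
     frechet_derivative (field_coord A c Y) (at (snd c p)) (X p)
     - frechet_derivative (field_coord A c X) (at (snd c p)) (Y p))"


section \<open>Hermitian manifolds\<close>

definition riemannian_metric ::
  "('m::topological_space, 'e::euclidean_space) chart set \<Rightarrow> ('m \<Rightarrow> 'e \<Rightarrow> 'e \<Rightarrow> real) \<Rightarrow> bool" where
  "riemannian_metric A g \<longleftrightarrow>
     (\<forall>p. bilinear (g p) \<and> (\<forall>u v. g p u v = g p v u) \<and> (\<forall>v. v \<noteq> 0 \<longrightarrow> 0 < g p v v)) \<and>
     (\<forall>p X Y. vector_field_near A p X \<longrightarrow> vector_field_near A p Y \<longrightarrow>
        smooth_near A p (\<lambda>q. g q (X q) (Y q)))"

definition almost_complex_structure ::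
  "('m::topological_space, 'e::euclidean_space) chart set \<Rightarrow> ('m \<Rightarrow> 'e \<Rightarrow> 'e) \<Rightarrow> bool" where
  "almost_complex_structure A J \<longleftrightarrow>
     (\<forall>p. linear (J p) \<and> (\<forall>v. J p (J p v) = - v)) \<and>
     (\<forall>p X. vector_field_near A p X \<longrightarrow> vector_field_near A p (\<lambda>q. J q (X q)))"

definition nijenhuis ::
  "('m, 'e::euclidean_space) chart set \<Rightarrow> ('m \<Rightarrow> 'e \<Rightarrow> 'e) \<Rightarrow> ('m \<Rightarrow> 'e) \<Rightarrow> ('m \<Rightarrow> 'e) \<Rightarrow> 'm \<Rightarrow> 'e"
  where
  "nijenhuis A J X Y p =
     lie_bracket A (\<lambda>q. J q (X q)) (\<lambda>q. J q (Y q)) p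
     - J p (lie_bracket A (\<lambda>q. J q (X q)) Y p)
     - J p (lie_bracket A X (\<lambda>q. J q (Y q)) p)
     - lie_bracket A X Y p"

definition integrable_complex_structure ::
  "('m::topological_space, 'e::euclidean_space) chart set \<Rightarrow> ('m \<Rightarrow> 'e \<Rightarrow> 'e) \<Rightarrow> bool" where
  "integrable_complex_structure A J \<longleftrightarrow> almost_complex_structure A J \<and>
     (\<forall>p X Y. vector_field_near A p X \<longrightarrow> vector_field_near A p Y \<longrightarrow> nijenhuis A J X Y p = 0)"

definition hermitian_manifold ::
  "('m::{t2_space, second_countable_topology}, 'e::euclidean_space) chart set \<Rightarrow>
   ('m \<Rightarrow> 'e \<Rightarrow> 'e \<Rightarrow> real) \<Rightarrow> ('m \<Rightarrow> 'e \<Rightarrow> 'e) \<Rightarrow> bool" where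
  "hermitian_manifold A g J \<longleftrightarrow> smooth_atlas A \<and> riemannian_metric A g \<and>
     integrable_complex_structure A J \<and> (\<forall>p u v. g p (J p u) (J p v) = g p u v)"

definition fundamental_form ::
  "('m \<Rightarrow> 'e \<Rightarrow> 'e \<Rightarrow> real) \<Rightarrow> ('m \<Rightarrow> 'e \<Rightarrow> 'e) \<Rightarrow> 'm \<Rightarrow> 'e \<Rightarrow> 'e \<Rightarrow> real" where
  "fundamental_form g J p u v = g p (J p u) v"

text \<open>
  The exterior derivative of a 2-form, with the normalisation without the factor \<open>1/3\<close>; this is
  the one for which the Strominger-Bismut connection below preserves \<open>J\<close>.
\<close>

definition ext_deriv2 ::
  "('m, 'e::euclidean_space) chart set \<Rightarrow> ('m \<Rightarrow> 'e \<Rightarrow> 'e \<Rightarrow> real) \<Rightarrow>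
   ('m \<Rightarrow> 'e) \<Rightarrow> ('m \<Rightarrow> 'e) \<Rightarrow> ('m \<Rightarrow> 'e) \<Rightarrow> 'm \<Rightarrow> real" where
  "ext_deriv2 A \<omega> X Y Z p =
     dir_deriv A p (X p) (\<lambda>q. \<omega> q (Y q) (Z q))
     - dir_deriv A p (Y p) (\<lambda>q. \<omega> q (X q) (Z q))
     + dir_deriv A p (Z p) (\<lambda>q. \<omega> q (X q) (Y q))
     - \<omega> p (lie_bracket A X Y p) (Z p)
     + \<omega> p (lie_bracket A X Z p) (Y p)
     - \<omega> p (lie_bracket A Y Z p) (X p)"


section \<open>Affine connections\<close>

text \<open>
  \<open>D p v Y\<close> is the covariant derivative at \<open>p\<close>, along \<open>v \<in> T\<^sub>pM\<close>, of a field \<open>Y\<close> that is smooth near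
  \<open>p\<close>.  The connection thus acts on locally defined fields, and \<open>(\<nabla>\<^sub>X Y)(p) = D p (X p) Y\<close>.
\<close>

type_synonym ('m, 'e) connection = "'m \<Rightarrow> 'e \<Rightarrow> ('m \<Rightarrow> 'e) \<Rightarrow> 'e"

definition affine_connection ::
  "('m::topological_space, 'e::euclidean_space) chart set \<Rightarrow> ('m, 'e) connection \<Rightarrow> bool" where
  "affine_connection A D \<longleftrightarrow>
     (\<forall>p Y. vector_field_near A p Y \<longrightarrow> linear (\<lambda>v. D p v Y)) \<and>
     (\<forall>p v Y Y'. vector_field_near A p Y \<longrightarrow> vector_field_near A p Y' \<longrightarrow>
        D p v (\<lambda>q. Y q + Y' q) = D p v Y + D p v Y') \<and>
     (\<forall>p v f Y. smooth_near A p f \<longrightarrow> vector_field_near A p Y \<longrightarrow>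
        D p v (\<lambda>q. f q *\<^sub>R Y q) = dir_deriv A p v f *\<^sub>R Y p + f p *\<^sub>R D p v Y) \<and>
     (\<forall>p v Y Y'. vector_field_near A p Y \<longrightarrow> eventually (\<lambda>q. Y q = Y' q) (nhds p) \<longrightarrow>
        D p v Y = D p v Y') \<and>
     (\<forall>p X Y. vector_field_near A p X \<longrightarrow> vector_field_near A p Y \<longrightarrow>
        vector_field_near A p (\<lambda>q. D q (X q) Y))"

definition levi_civita ::
  "('m::topological_space, 'e::euclidean_space) chart set \<Rightarrow> ('m \<Rightarrow> 'e \<Rightarrow> 'e \<Rightarrow> real) \<Rightarrow>
   ('m, 'e) connection \<Rightarrow> bool" where
  "levi_civita A g D \<longleftrightarrow> affine_connection A D \<and>
     (\<forall>p v Y Z. vector_field_near A p Y \<longrightarrow> vector_field_near A p Z \<longrightarrow>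
        dir_deriv A p v (\<lambda>q. g q (Y q) (Z q)) = g p (D p v Y) (Z p) + g p (Y p) (D p v Z)) \<and>
     (\<forall>p X Y. vector_field_near A p X \<longrightarrow> vector_field_near A p Y \<longrightarrow>
        D p (X p) Y - D p (Y p) X = lie_bracket A X Y p)"

definition strominger_bismut ::
  "('m::topological_space, 'e::euclidean_space) chart set \<Rightarrow> ('m \<Rightarrow> 'e \<Rightarrow> 'e \<Rightarrow> real) \<Rightarrow>
   ('m \<Rightarrow> 'e \<Rightarrow> 'e) \<Rightarrow> ('m, 'e) connection \<Rightarrow> ('m, 'e) connection \<Rightarrow> bool" where
  "strominger_bismut A g J LC SB \<longleftrightarrow> affine_connection A SB \<and>
     (\<forall>p X Y Z. vector_field_near A p X \<longrightarrow> vector_field_near A p Y \<longrightarrow> vector_field_near A p Z \<longrightarrow>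
        g p (SB p (X p) Y) (Z p) = g p (LC p (X p) Y) (Z p)
          + 1/2 * ext_deriv2 A (fundamental_form g J)
              (\<lambda>q. J q (X q)) (\<lambda>q. J q (Y q)) (\<lambda>q. J q (Z q)) p)"

definition torsion ::
  "('m, 'e::euclidean_space) chart set \<Rightarrow> ('m, 'e) connection \<Rightarrow>
   ('m \<Rightarrow> 'e) \<Rightarrow> ('m \<Rightarrow> 'e) \<Rightarrow> 'm \<Rightarrow> 'e" where
  "torsion A D X Y p = D p (X p) Y - D p (Y p) X - lie_bracket A X Y p"

definition curvature ::
  "('m, 'e::euclidean_space) chart set \<Rightarrow> ('m, 'e) connection \<Rightarrow>
   ('m \<Rightarrow> 'e) \<Rightarrow> ('m \<Rightarrow> 'e) \<Rightarrow> ('m \<Rightarrow> 'e) \<Rightarrow> 'm \<Rightarrow> 'e" where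
  "curvature A D X Y Z p =
     D p (X p) (\<lambda>q. D q (Y q) Z) - D p (Y p) (\<lambda>q. D q (X q) Z) - D p (lie_bracket A X Y p) Z"

text \<open>
  Torsion and curvature are tensors, so they are evaluated on tangent vectors at \<open>p\<close> by extending
  these arbitrarily to smooth local fields.
\<close>

definition extend ::
  "('m::topological_space, 'e::euclidean_space) chart set \<Rightarrow> 'm \<Rightarrow> 'e \<Rightarrow> ('m \<Rightarrow> 'e)" where
  "extend A p v = (SOME X. vector_field_near A p X \<and> X p = v)"

definition torsion_tensor ::
  "('m::topological_space, 'e::euclidean_space) chart set \<Rightarrow> ('m \<Rightarrow> 'e \<Rightarrow> 'e \<Rightarrow> real) \<Rightarrow>
   ('m, 'e) connection \<Rightarrow> 'm \<Rightarrow> 'e \<Rightarrow> 'e \<Rightarrow> 'e \<Rightarrow> real" where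
  "torsion_tensor A g D p x y z = g p (torsion A D (extend A p x) (extend A p y) p) z"

definition curvature_tensor ::
  "('m::topological_space, 'e::euclidean_space) chart set \<Rightarrow> ('m \<Rightarrow> 'e \<Rightarrow> 'e \<Rightarrow> real) \<Rightarrow>
   ('m, 'e) connection \<Rightarrow> 'm \<Rightarrow> 'e \<Rightarrow> 'e \<Rightarrow> 'e \<Rightarrow> 'e \<Rightarrow> real" where
  "curvature_tensor A g D p x y z w =
     g p (curvature A D (extend A p x) (extend A p y) (extend A p z) p) w"


section \<open>Maps into the manifold and the induced connection\<close>

definition smooth_map_on ::
  "('m::topological_space, 'e::euclidean_space) chart set \<Rightarrow> 'p::euclidean_space set \<Rightarrow>
   ('p \<Rightarrow> 'm) \<Rightarrow> bool" where
  "smooth_map_on A S f \<longleftrightarrow> continuous_on S f \<and>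
     (\<forall>c\<in>A. smooth_on (S \<inter> f -` fst c) (\<lambda>x. snd c (f x)))"

text \<open>\<open>pushforward A S f u x\<close> is \<open>f\<^sub>*u \<in> T\<^bsub>f x\<^esub>M\<close> for \<open>u\<close> tangent to the parameter domain \<open>S\<close> at \<open>x\<close>.\<close>

definition pushforward ::
  "('m, 'e::euclidean_space) chart set \<Rightarrow> 'p::euclidean_space set \<Rightarrow> ('p \<Rightarrow> 'm) \<Rightarrow> 'p \<Rightarrow> 'p \<Rightarrow> 'e"
  where
  "pushforward A S f u x =
     frechet_derivative (\<lambda>y. snd (chart_at A (f x)) (f y)) (at x within S) u"

text \<open>
  The connection induced by \<open>D\<close> on \<open>f\<^sup>*TM\<close>, applied along \<open>u\<close> to a field \<open>V\<close> along \<open>f\<close>.  It is the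
  unique connection with \<open>\<nabla>\<^sub>u (Y \<circ> f) = D\<^bsub>f\<^sub>*u\<^esub> Y\<close>; writing \<open>V = \<Sum> V\<^sup>b (e\<^sub>b \<circ> f)\<close> in the coordinate
  fields \<open>e\<^sub>b\<close> of a chart, this means
  \<open>\<nabla>\<^sub>u V = \<Sum> u(V\<^sup>b) (e\<^sub>b \<circ> f) + \<Sum> V\<^sup>b D\<^bsub>f\<^sub>*u\<^esub> e\<^sub>b\<close>.
  In the chart \<open>c\<close> that represents \<open>T\<^bsub>f x\<^esub>M\<close> one has \<open>e\<^sub>b (f x) = b\<close>, so the first sum is the
  derivative of the component vector of \<open>V\<close>.
\<close>

definition induced_deriv ::
  "('m, 'e::euclidean_space) chart set \<Rightarrow> ('m, 'e) connection \<Rightarrow>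
   ('p::euclidean_space \<Rightarrow> 'm) \<Rightarrow> 'p set \<Rightarrow> 'p \<Rightarrow> ('p \<Rightarrow> 'e) \<Rightarrow> 'p \<Rightarrow> 'e" where
  "induced_deriv A D f S u V x = (let c = chart_at A (f x) in
     frechet_derivative (\<lambda>y. tcoord A c (f y) (V y)) (at x within S) u
     + (\<Sum>b\<in>Basis. (V x \<bullet> b) *\<^sub>R D (f x) (pushforward A S f u x) (\<lambda>q. tvec A c q b)))"

definition velocity ::
  "('m, 'e::euclidean_space) chart set \<Rightarrow> real \<Rightarrow> real \<Rightarrow> (real \<Rightarrow> 'm) \<Rightarrow> real \<Rightarrow> 'e" where
  "velocity A a b \<gamma> t = pushforward A {a..b} \<gamma> 1 t"

definition geodesic ::
  "('m::topological_space, 'e::euclidean_space) chart set \<Rightarrow> ('m, 'e) connection \<Rightarrow>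
   real \<Rightarrow> real \<Rightarrow> (real \<Rightarrow> 'm) \<Rightarrow> bool" where
  "geodesic A D a b \<gamma> \<longleftrightarrow> smooth_map_on A {a..b} \<gamma> \<and>
     (\<forall>t\<in>{a..b}. induced_deriv A D \<gamma> {a..b} 1 (velocity A a b \<gamma>) t = 0)"

definition unit_speed ::
  "('m, 'e::euclidean_space) chart set \<Rightarrow> ('m \<Rightarrow> 'e \<Rightarrow> 'e \<Rightarrow> real) \<Rightarrow>
   real \<Rightarrow> real \<Rightarrow> (real \<Rightarrow> 'm) \<Rightarrow> bool" where
  "unit_speed A g a b \<gamma> \<longleftrightarrow>
     (\<forall>t\<in>{a..b}. sqrt (g (\<gamma> t) (velocity A a b \<gamma> t) (velocity A a b \<gamma> t)) = 1)"

definition energy ::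
  "('m, 'e::euclidean_space) chart set \<Rightarrow> ('m \<Rightarrow> 'e \<Rightarrow> 'e \<Rightarrow> real) \<Rightarrow>
   real \<Rightarrow> real \<Rightarrow> (real \<Rightarrow> 'm) \<Rightarrow> real" where
  "energy A g a b c =
     1/2 * integral {a..b} (\<lambda>t. g (c t) (velocity A a b c t) (velocity A a b c t))"

text \<open>
  \<open>has_mixed_partial F L x y\<close>: the derivative \<open>\<partial>\<^sup>2F/\<partial>s\<^sub>1\<partial>s\<^sub>2 = \<partial>/\<partial>s\<^sub>1 (\<partial>F/\<partial>s\<^sub>2)\<close> exists at \<open>(x,y)\<close> and equals \<open>L\<close>.
\<close>

definition has_mixed_partial ::
  "(real \<Rightarrow> real \<Rightarrow> real) \<Rightarrow> real \<Rightarrow> real \<Rightarrow> real \<Rightarrow> bool" where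
  "has_mixed_partial F L x y \<longleftrightarrow>
     (\<exists>F2. eventually (\<lambda>s. ((\<lambda>r. F s r) has_real_derivative F2 s) (at y)) (nhds x) \<and>
           (F2 has_real_derivative L) (at x))"

end

theory Submission
  imports Defs
begin

text \<open>
  The formula rests on two properties of the Strominger-Bismut connection \<open>\<nabla>\<close>: it preserves the
  metric, and its torsion is totally skew. Both follow from its definition, because \<open>d\<omega>(J\<cdot>, J\<cdot>,
  J\<cdot>)\<close> is alternating and the Levi-Civita connection is metric and torsion free (\<open>SB_metric\<close>,
  \<open>SB_torsion_skew\<close>). The same alternation shows that \<open>\<nabla>\<close> has the geodesics of the Levi-Civita
  connection (\<open>SB_LC_acceleration\<close>).

  Write \<open>\<alpha>\<^sub>t\<close>, \<open>\<alpha>\<^sub>1\<close>, \<open>\<alpha>\<^sub>2\<close> for the partial velocities of the variation and \<open>\<nabla>\<^sub>t\<close>, \<open>\<nabla>\<^sub>1\<close>, \<open>\<nabla>\<^sub>2\<close>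
  for the induced derivatives. There are three rules of calculation for fields along a map: the
  product rule for the metric (\<open>metric_compatible\<close>), \<open>\<nabla>\<^sub>i \<alpha>\<^sub>j - \<nabla>\<^sub>j \<alpha>\<^sub>i = T(\<alpha>\<^sub>i, \<alpha>\<^sub>j)\<close>
  (\<open>nab_torsion\<close>), and \<open>\<nabla>\<^sub>i \<nabla>\<^sub>j X - \<nabla>\<^sub>j \<nabla>\<^sub>i X = R(\<alpha>\<^sub>i, \<alpha>\<^sub>j) X\<close> (\<open>nab_curvature\<close>). The first two
  and the skewness of \<open>T\<close> give \<open>1/2 \<partial>\<^sub>2 |\<alpha>\<^sub>t|\<^sup>2 = \<langle>\<nabla>\<^sub>t \<alpha>\<^sub>2, \<alpha>\<^sub>t\<rangle>\<close>. Another derivative gives \<open>\<partial>\<^sub>1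
  \<langle>\<nabla>\<^sub>t \<alpha>\<^sub>2, \<alpha>\<^sub>t\<rangle> = \<langle>\<nabla>\<^sub>1 \<nabla>\<^sub>t \<alpha>\<^sub>2, \<alpha>\<^sub>t\<rangle> + \<langle>\<nabla>\<^sub>t \<alpha>\<^sub>2, \<nabla>\<^sub>1 \<alpha>\<^sub>t\<rangle>\<close>, and commuting the derivatives turns
  this, at \<open>s\<^sub>1 = s\<^sub>2 = 0\<close> where \<open>\<nabla>\<^sub>t \<alpha>\<^sub>t = 0\<close>, into the index form plus \<open>\<partial>\<^sub>t \<langle>\<nabla>\<^sub>1 \<alpha>\<^sub>2, \<alpha>\<^sub>t\<rangle>\<close>
  (\<open>second_variation_integrand\<close>). The sign of the curvature term uses \<open>\<langle>R X, Y\<rangle> = - \<langle>X, R Y\<rangle>\<close>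
  (\<open>nab_commutator_skew\<close>). Integration over \<open>[a, b]\<close>, with differentiation under the integral sign
  and the fundamental theorem of calculus, yields the formula.

  The three rules are local and are proved in coordinates. The tangent space at each point carries
  its own preferred chart, which changes without any continuity from point to point, so the key
  step is that the induced derivative has the usual expression \<open>\<partial>\<^sub>u X + \<Gamma>(\<partial>\<^sub>u f, X)\<close> in every
  fixed chart (\<open>induced_coord\<close>). Derivatives at the end points \<open>t = a\<close> and \<open>t = b\<close> are one-sided;
  the symmetry of second derivatives holds there by density of the interior (\<open>ddir_commute\<close>).
\<close>

section \<open>Calculus of smooth maps\<close>

lemma Ck_on_cong:
  assumes "\<And>x. x \<in> S \<Longrightarrow> f x = h x"
  shows "Ck_on k S f \<longleftrightarrow> Ck_on k S h"
proof (cases k)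
  case 0
  then show ?thesis using assms by (simp cong: continuous_on_cong)
next
  case (Suc j)
  have "(f has_derivative d) (at x within S) \<longleftrightarrow> (h has_derivative d) (at x within S)"
    if "x \<in> S" for d x
    using has_derivative_transform[of x S f h d] has_derivative_transform[of x S h f d] assms that
    by metis
  then show ?thesis by (simp add: Suc)
qed

lemma Ck_on_subset: "Ck_on k S f \<Longrightarrow> T \<subseteq> S \<Longrightarrow> Ck_on k T f"
proof (induction k arbitrary: f)
  case 0
  then show ?case by (auto intro: continuous_on_subset)
next
  case (Suc k)
  then obtain f' where f': "\<forall>x\<in>S. (f has_derivative f' x) (at x within S)"
    "\<forall>v. Ck_on k S (\<lambda>x. f' x v)" by auto
  show ?case
    unfolding Ck_on.simps
    using f' Suc by (intro exI[of _ f']) (blast intro: has_derivative_subset)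
qed

lemma Ck_on_SucD: "Ck_on (Suc k) S f \<Longrightarrow> Ck_on k S f"
proof (induction k arbitrary: f)
  case 0
  then show ?case
    using has_derivative_continuous by (fastforce simp: continuous_on_eq_continuous_within)
next
  case (Suc k)
  then show ?case by (metis Ck_on.simps(2))
qed

lemma Ck_on_continuous: "Ck_on k S f \<Longrightarrow> continuous_on S f"
  by (induction k) (auto dest: Ck_on_SucD simp del: Ck_on.simps(2))

lemma Ck_on_const: "Ck_on k S (\<lambda>x. c)"
proof (induction k arbitrary: c)
  case (Suc k)
  show ?case unfolding Ck_on.simps
    by (rule exI[of _ "\<lambda>x v. 0"]) (use Suc in auto)
qed simp

lemma Ck_on_bounded_linear_compose:
  assumes "bounded_linear L"
  shows "Ck_on k S f \<Longrightarrow> Ck_on k S (\<lambda>x. L (f x))"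
proof (induction k arbitrary: f)
  case 0
  then show ?case by (simp add: assms bounded_linear.continuous_on)
next
  case (Suc k)
  then obtain f' where f': "\<forall>x\<in>S. (f has_derivative f' x) (at x within S)"
    "\<forall>v. Ck_on k S (\<lambda>x. f' x v)" by auto
  show ?case
    unfolding Ck_on.simps
    using f' Suc by (intro exI[of _ "\<lambda>x v. L (f' x v)"])
      (auto intro: bounded_linear.has_derivative[OF assms])
qed

lemma Ck_on_add: "Ck_on k S f \<Longrightarrow> Ck_on k S h \<Longrightarrow> Ck_on k S (\<lambda>x. f x + h x)"
proof (induction k arbitrary: f h)
  case 0
  then show ?case by (simp add: continuous_on_add)
next
  case (Suc k)
  then obtain f' h' where "\<forall>x\<in>S. (f has_derivative f' x) (at x within S)"
    "\<forall>v. Ck_on k S (\<lambda>x. f' x v)" "\<forall>x\<in>S. (h has_derivative h' x) (at x within S)"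
    "\<forall>v. Ck_on k S (\<lambda>x. h' x v)" by auto
  then show ?case
    unfolding Ck_on.simps
    using Suc.IH by (intro exI[of _ "\<lambda>x v. f' x v + h' x v"]) (auto intro: has_derivative_add)
qed

lemma Ck_on_sum: "finite I \<Longrightarrow> (\<And>i. i \<in> I \<Longrightarrow> Ck_on k S (f i)) \<Longrightarrow> Ck_on k S (\<lambda>x. \<Sum>i\<in>I. f i x)"
  by (induction I rule: finite_induct) (auto intro: Ck_on_const Ck_on_add)

lemma Ck_on_scaleR: "Ck_on k S f \<Longrightarrow> Ck_on k S h \<Longrightarrow> Ck_on k S (\<lambda>x. f x *\<^sub>R h x)"
proof (induction k arbitrary: f h)
  case 0
  then show ?case by (simp add: continuous_on_scaleR)
next
  case (Suc k)
  obtain f' h' where *: "\<forall>x\<in>S. (f has_derivative f' x) (at x within S)"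
    "\<forall>v. Ck_on k S (\<lambda>x. f' x v)" "\<forall>x\<in>S. (h has_derivative h' x) (at x within S)"
    "\<forall>v. Ck_on k S (\<lambda>x. h' x v)" using Suc.prems by auto
  moreover have "Ck_on k S f" "Ck_on k S h"
    using Suc.prems Ck_on_SucD by blast+
  ultimately show ?case
    unfolding Ck_on.simps
    using Suc.IH by (intro exI[of _ "\<lambda>x v. f x *\<^sub>R h' x v + f' x v *\<^sub>R h x"])
      (auto intro: has_derivative_scaleR Ck_on_add)
qed

text \<open>
  In \<open>D(h \<circ> f)(x) v = Dh(f x)(Df(x) v)\<close> the direction varies with \<open>x\<close>, so it is expanded in the
  standard basis before the induction hypothesis is applied.
\<close>

lemma Ck_on_compose:
  "Ck_on k S f \<Longrightarrow> f ` S \<subseteq> T \<Longrightarrow> Ck_on k T h \<Longrightarrow> Ck_on k S (\<lambda>x. h (f x))"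
proof (induction k arbitrary: h)
  case 0
  then show ?case by (auto intro: continuous_on_compose2)
next
  case (Suc k)
  obtain f' h' where *: "\<forall>x\<in>S. (f has_derivative f' x) (at x within S)"
    "\<forall>v. Ck_on k S (\<lambda>x. f' x v)" "\<forall>x\<in>T. (h has_derivative h' x) (at x within T)"
    "\<forall>v. Ck_on k T (\<lambda>x. h' x v)" using Suc.prems by auto
  have f: "Ck_on k S f" using Suc.prems Ck_on_SucD by blast
  have der: "((\<lambda>x. h (f x)) has_derivative (\<lambda>v. h' (f x) (f' x v))) (at x within S)" if "x \<in> S"
      for x
  proof (rule has_derivative_in_compose2[where t=T and g=h])
    show "(h has_derivative h' y) (at y within T)" if "y \<in> T" for y using * that by blast
  qed (use * Suc.prems that in auto)
  have "Ck_on k S (\<lambda>x. h' (f x) (f' x v))" for v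
  proof -
    have "Ck_on k S (\<lambda>x. \<Sum>b\<in>Basis. (f' x v \<bullet> b) *\<^sub>R h' (f x) b)"
      using * f Suc.prems
      by (intro Ck_on_sum Ck_on_scaleR Suc.IH Ck_on_bounded_linear_compose[of "\<lambda>x. x \<bullet> b" for b])
        (auto intro: bounded_linear_inner_left)
    moreover have "(\<Sum>b\<in>Basis. (f' x v \<bullet> b) *\<^sub>R h' (f x) b) = h' (f x) (f' x v)" if "x \<in> S" for x
    proof -
      have "linear (h' (f x))"
        using * Suc.prems that by (meson has_derivative_linear image_subset_iff)
      then have "h' (f x) (\<Sum>b\<in>Basis. (f' x v \<bullet> b) *\<^sub>R b) = (\<Sum>b\<in>Basis. (f' x v \<bullet> b) *\<^sub>R h' (f x) b)"
        by (simp add: linear_sum linear_cmul)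
      then show ?thesis by (simp add: euclidean_representation)
    qed
    ultimately show ?thesis by (subst (asm) Ck_on_cong) auto
  qed
  then show ?case
    unfolding Ck_on.simps using der by (intro exI[of _ "\<lambda>x v. h' (f x) (f' x v)"]) blast
qed

lemma smooth_on_cong:
  "(\<And>x. x \<in> S \<Longrightarrow> f x = h x) \<Longrightarrow> smooth_on S f \<longleftrightarrow> smooth_on S h"
  unfolding smooth_on_def using Ck_on_cong by blast

lemma smooth_on_subset: "smooth_on S f \<Longrightarrow> T \<subseteq> S \<Longrightarrow> smooth_on T f"
  unfolding smooth_on_def using Ck_on_subset by blast

lemma smooth_on_continuous: "smooth_on S f \<Longrightarrow> continuous_on S f"
  unfolding smooth_on_def using Ck_on_continuous by blast

lemma smooth_on_const: "smooth_on S (\<lambda>x. c)"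
  unfolding smooth_on_def using Ck_on_const by blast

lemma smooth_on_bounded_linear_compose:
  "bounded_linear L \<Longrightarrow> smooth_on S f \<Longrightarrow> smooth_on S (\<lambda>x. L (f x))"
  unfolding smooth_on_def using Ck_on_bounded_linear_compose by blast

lemma smooth_on_inner_const: "smooth_on S f \<Longrightarrow> smooth_on S (\<lambda>x. f x \<bullet> b)"
  by (rule smooth_on_bounded_linear_compose[OF bounded_linear_inner_left])

lemma smooth_on_add: "smooth_on S f \<Longrightarrow> smooth_on S h \<Longrightarrow> smooth_on S (\<lambda>x. f x + h x)"
  unfolding smooth_on_def using Ck_on_add by blast

lemma smooth_on_sum:
  "(\<And>i. i \<in> I \<Longrightarrow> smooth_on S (f i)) \<Longrightarrow> finite I \<Longrightarrow> smooth_on S (\<lambda>x. \<Sum>i\<in>I. f i x)"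
  unfolding smooth_on_def using Ck_on_sum by blast

lemma smooth_on_scaleR:
  "smooth_on S f \<Longrightarrow> smooth_on S h \<Longrightarrow> smooth_on S (\<lambda>x. f x *\<^sub>R h x)"
  unfolding smooth_on_def using Ck_on_scaleR by blast

lemma smooth_on_compose:
  "smooth_on T h \<Longrightarrow> smooth_on S f \<Longrightarrow> f ` S \<subseteq> T \<Longrightarrow> smooth_on S (\<lambda>x. h (f x))"
  unfolding smooth_on_def using Ck_on_compose by blast


section \<open>Domains on which derivatives are unique\<close>

text \<open>
  The coordinate directions make the derivative within \<open>S\<close> unique, so that it may be called
  \<^const>\<open>frechet_derivative\<close>; density of the interior carries identities between continuous
  derivatives, in particular the symmetry of second derivatives, over to the boundary.
\<close>

definition deriv_domain :: "'a::euclidean_space set \<Rightarrow> bool" where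
  "deriv_domain S \<longleftrightarrow> S \<subseteq> closure (interior S) \<and>
     (\<forall>x\<in>S. \<forall>b\<in>Basis. \<forall>e>0. \<exists>d. 0 < \<bar>d\<bar> \<and> \<bar>d\<bar> < e \<and> x + d *\<^sub>R b \<in> S)"

lemma deriv_domain_Int_open:
  fixes S :: "'a::euclidean_space set"
  assumes S: "deriv_domain S" and U: "open U"
  shows "deriv_domain (S \<inter> U)"
  unfolding deriv_domain_def
proof (intro conjI ballI allI impI)
  have "S \<inter> U \<subseteq> closure (interior S) \<inter> U" using S by (auto simp: deriv_domain_def)
  also have "\<dots> \<subseteq> closure (interior S \<inter> U)"
    using open_Int_closure_subset[OF U, of "interior S"] by (simp add: Int_commute)
  finally show "S \<inter> U \<subseteq> closure (interior (S \<inter> U))" by (simp add: U interior_open)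
next
  fix x b :: 'a and e :: real
  assume x: "x \<in> S \<inter> U" and b: "b \<in> Basis" and e: "0 < e"
  then obtain r where r: "r > 0" "ball x r \<subseteq> U" using U open_contains_ball by blast
  obtain d where d: "0 < \<bar>d\<bar>" "\<bar>d\<bar> < min e r" "x + d *\<^sub>R b \<in> S"
    using S x b e r unfolding deriv_domain_def by (metis IntE min_less_iff_conj)
  have "x + d *\<^sub>R b \<in> ball x r" using d b by (simp add: dist_norm)
  then show "\<exists>d. 0 < \<bar>d\<bar> \<and> \<bar>d\<bar> < e \<and> x + d *\<^sub>R b \<in> S \<inter> U" using d r by auto
qed

lemma deriv_domain_open:
  fixes S :: "'a::euclidean_space set"
  assumes "open S" shows "deriv_domain S"
proof -
  have "deriv_domain (UNIV :: 'a set)"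
    unfolding deriv_domain_def
  proof (intro conjI ballI allI impI)
    fix e :: real assume "0 < e"
    then show "\<exists>d. 0 < \<bar>d\<bar> \<and> \<bar>d\<bar> < e \<and> x + d *\<^sub>R b \<in> UNIV" for x b :: 'a
      by (intro exI[of _ "e/2"]) auto
  qed auto
  from deriv_domain_Int_open[OF this assms] show ?thesis by simp
qed

lemma deriv_domain_Icc:
  fixes a b :: real
  assumes "a < b" shows "deriv_domain {a..b}"
  unfolding deriv_domain_def
proof (intro conjI ballI allI impI)
  show "{a..b} \<subseteq> closure (interior {a..b})" using assms by (simp add: interior_atLeastAtMost_real)
next
  fix x i e :: real assume x: "x \<in> {a..b}" and i: "i \<in> Basis" and e: "0 < e"
  show "\<exists>d. 0 < \<bar>d\<bar> \<and> \<bar>d\<bar> < e \<and> x + d *\<^sub>R i \<in> {a..b}"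
  proof (cases "x < b")
    case True
    with x i e show ?thesis
      by (intro exI[of _ "min (e/2) (b - x)"]) auto
  next
    case False
    with x i e assms show ?thesis
      by (intro exI[of _ "- min (e/2) (b - a)"]) (auto simp: min_def)
  qed
qed

lemma deriv_domain_Times:
  assumes "deriv_domain S" "deriv_domain T"
  shows "deriv_domain (S \<times> T)"
  unfolding deriv_domain_def
proof (intro conjI ballI allI impI)
  show "S \<times> T \<subseteq> closure (interior (S \<times> T))"
    using assms unfolding deriv_domain_def interior_Times closure_Times by blast
next
  fix z b :: "'a \<times> 'b" and e :: real
  assume z: "z \<in> S \<times> T" and b: "b \<in> Basis" and e: "0 < e"
  consider i where "i \<in> Basis" "b = (i, 0)" | j where "j \<in> Basis" "b = (0, j)"
    using b unfolding Basis_prod_def by blast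
  then show "\<exists>d. 0 < \<bar>d\<bar> \<and> \<bar>d\<bar> < e \<and> z + d *\<^sub>R b \<in> S \<times> T"
  proof cases
    case 1
    then obtain d where "0 < \<bar>d\<bar>" "\<bar>d\<bar> < e" "fst z + d *\<^sub>R i \<in> S"
      using assms(1) z e unfolding deriv_domain_def by (metis mem_Times_iff)
    then show ?thesis using 1 z by (intro exI[of _ d]) (auto simp: mem_Times_iff)
  next
    case 2
    then obtain d where "0 < \<bar>d\<bar>" "\<bar>d\<bar> < e" "snd z + d *\<^sub>R j \<in> T"
      using assms(2) z e unfolding deriv_domain_def by (metis mem_Times_iff)
    then show ?thesis using 2 z by (intro exI[of _ d]) (auto simp: mem_Times_iff)
  qed
qed

text \<open>
  The derivative of \<open>f\<close> in direction \<open>u\<close>, as a function of the point, so that it can be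
  differentiated again.
\<close>

definition ddir :: "'a::euclidean_space set \<Rightarrow> 'a \<Rightarrow> ('a \<Rightarrow> 'b::real_normed_vector) \<Rightarrow> 'a \<Rightarrow> 'b" where
  "ddir S u f x = frechet_derivative f (at x within S) u"

lemma has_derivative_unique_on:
  assumes "deriv_domain S" "x \<in> S"
    and "(f has_derivative f') (at x within S)" "(f has_derivative f'') (at x within S)"
  shows "f' = f''"
  by (rule frechet_derivative_unique_within[OF assms(3,4)])
    (use assms(1,2) in \<open>auto simp: deriv_domain_def\<close>)

lemma ddir_eq:
  assumes "(f has_derivative f') (at x within S)" "deriv_domain S" "x \<in> S"
  shows "ddir S u f x = f' u"
proof -
  have "(f has_derivative frechet_derivative f (at x within S)) (at x within S)"
    using assms(1) differentiable_def frechet_derivative_works by blast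
  then show ?thesis using has_derivative_unique_on[OF assms(2,3,1)] by (simp add: ddir_def)
qed

lemma at_within_Int_open:
  assumes "open U" "x \<in> U" shows "at x within (S \<inter> U) = at x within S"
  using assms by (intro at_within_nhd[of x U]) auto

lemma ddir_Int_open:
  assumes "open U" "x \<in> U" shows "ddir (S \<inter> U) u f x = ddir S u f x"
  by (simp add: ddir_def at_within_Int_open[OF assms])

lemma has_derivative_cong_Int_open:
  assumes U: "open U" "x \<in> U" "x \<in> S" and eq: "\<And>z. z \<in> S \<inter> U \<Longrightarrow> f z = h z"
  shows "(f has_derivative d) (at x within S) \<longleftrightarrow> (h has_derivative d) (at x within S)"
proof -
  have "(f has_derivative d) (at x within S \<inter> U) \<longleftrightarrow> (h has_derivative d) (at x within S \<inter> U)"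
    using has_derivative_transform[of x "S \<inter> U" f h d] has_derivative_transform[of x "S \<inter> U" h f d]
      U eq by (metis IntI)
  then show ?thesis by (simp add: at_within_Int_open[OF U(1,2)])
qed

lemma ddir_cong_Int_open:
  assumes "open U" "x \<in> U" "x \<in> S" and "\<And>z. z \<in> S \<inter> U \<Longrightarrow> f z = h z"
  shows "ddir S u f x = ddir S u h x"
  unfolding ddir_def frechet_derivative_def
  using has_derivative_cong_Int_open[OF assms] by presburger

lemma Ck_on_Suc_ddir:
  assumes "deriv_domain S"
  shows "Ck_on (Suc k) S f \<longleftrightarrow>
    (\<forall>x\<in>S. (f has_derivative (\<lambda>u. ddir S u f x)) (at x within S)) \<and> (\<forall>v. Ck_on k S (ddir S v f))"
    (is "?L = ?R")
proof
  assume ?L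
  then obtain f' where f': "\<forall>x\<in>S. (f has_derivative f' x) (at x within S)"
    "\<forall>v. Ck_on k S (\<lambda>x. f' x v)" by auto
  have eq: "f' x v = ddir S v f x" if "x \<in> S" for x v
    using f' that ddir_eq[OF _ assms that] by metis
  have "Ck_on k S (ddir S v f)" for v
    using f'(2) Ck_on_cong[of S "\<lambda>x. f' x v" "ddir S v f" k] eq by simp
  moreover have "(\<lambda>u. ddir S u f x) = f' x" if "x \<in> S" for x using eq[OF that] by auto
  ultimately show ?R using f' by simp
next
  assume ?R then show ?L unfolding Ck_on.simps by (intro exI[of _ "\<lambda>x u. ddir S u f x"]) auto
qed

lemma smooth_on_has_derivative:
  assumes "smooth_on S f" "deriv_domain S" "x \<in> S"
  shows "(f has_derivative (\<lambda>u. ddir S u f x)) (at x within S)"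
  using assms Ck_on_Suc_ddir smooth_on_def by blast

lemma smooth_on_ddir:
  assumes "smooth_on S f" "deriv_domain S"
  shows "smooth_on S (ddir S u f)"
  using assms Ck_on_Suc_ddir unfolding smooth_on_def by blast

text \<open>
  Smoothness asserts the existence of derivatives. Those found on different neighbourhoods agree
  on overlaps because derivatives within \<open>S\<close> are unique, so they glue to one derivative on \<open>S\<close>.
\<close>

lemma smooth_on_locally:
  assumes S: "deriv_domain S"
    and loc: "\<And>x. x \<in> S \<Longrightarrow> \<exists>U. open U \<and> x \<in> U \<and> smooth_on (S \<inter> U) f"
  shows "smooth_on S f"
proof -
  have "Ck_on k S f" if "\<And>x. x \<in> S \<Longrightarrow> \<exists>U. open U \<and> x \<in> U \<and> Ck_on k (S \<inter> U) f" for k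
    using that
  proof (induction k arbitrary: f)
    case 0
    show ?case
      unfolding Ck_on.simps continuous_on_eq_continuous_within
    proof
      fix x assume "x \<in> S"
      then obtain U where U: "open U" "x \<in> U" "continuous_on (S \<inter> U) f" using 0 by auto
      then have "continuous (at x within S \<inter> U) f"
        using \<open>x \<in> S\<close> by (auto simp: continuous_on_eq_continuous_within)
      then show "continuous (at x within S) f" by (simp add: at_within_Int_open[OF U(1,2)])
    qed
  next
    case (Suc k)
    have *: "\<exists>U. open U \<and> x \<in> U \<and> (f has_derivative (\<lambda>u. ddir S u f x)) (at x within S)
        \<and> (\<forall>v. Ck_on k (S \<inter> U) (ddir S v f))" if x: "x \<in> S" for x
    proof -
      obtain U where U: "open U" "x \<in> U" "Ck_on (Suc k) (S \<inter> U) f" using Suc.prems[OF x] by auto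
      note R = U(3)[unfolded Ck_on_Suc_ddir[OF deriv_domain_Int_open[OF S U(1)]]]
      have "(f has_derivative (\<lambda>u. ddir (S \<inter> U) u f x)) (at x within S)"
        using R x U by (metis IntI at_within_Int_open)
      moreover have "Ck_on k (S \<inter> U) (ddir S v f)" for v
        using R Ck_on_cong[of "S \<inter> U" "ddir (S \<inter> U) v f" "ddir S v f" k] ddir_Int_open[OF U(1)]
        by (metis IntD2)
      ultimately show ?thesis using U by (auto simp: ddir_Int_open)
    qed
    show ?case unfolding Ck_on_Suc_ddir[OF S] using * by (meson Suc.IH)
  qed
  then show ?thesis using loc unfolding smooth_on_def by meson
qed


text \<open>
  The second difference of \<open>f\<close> over a parallelogram with sides \<open>r u\<close> and \<open>r v\<close> is symmetric in \<open>u\<close>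
  and \<open>v\<close>, and by the mean value theorem, applied twice, it equals \<open>r\<^sup>2\<close> times a mixed derivative
  at an intermediate point.
\<close>

lemma second_difference_mean_value:
  fixes f :: "'a::euclidean_space \<Rightarrow> real"
  assumes f: "smooth_on S f" and S: "open S" and r: "r > 0"
    and box: "\<And>p q. 0 \<le> p \<Longrightarrow> p \<le> r \<Longrightarrow> 0 \<le> q \<Longrightarrow> q \<le> r \<Longrightarrow> x + p *\<^sub>R u + q *\<^sub>R v \<in> S"
  obtains p q where "0 \<le> p" "p \<le> r" "0 \<le> q" "q \<le> r"
    "f (x + r *\<^sub>R u + r *\<^sub>R v) - f (x + r *\<^sub>R u) - f (x + r *\<^sub>R v) + f x
       = r * r * ddir S v (ddir S u f) (x + p *\<^sub>R u + q *\<^sub>R v)"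
proof -
  note dom = deriv_domain_open[OF S]
  have sm: "smooth_on S (ddir S u f)" by (rule smooth_on_ddir[OF f dom])
  have D: "(h has_derivative (\<lambda>w. ddir S w h z)) (at z)" if "smooth_on S h" "z \<in> S"
    for z and h :: "'a \<Rightarrow> real"
    using smooth_on_has_derivative[OF that(1) dom that(2)] at_within_open[OF that(2) S] by simp
  have lin: "ddir S (t *\<^sub>R w) h z = t * ddir S w h z" if "smooth_on S h" "z \<in> S"
    for z w t and h :: "'a \<Rightarrow> real"
    using linear_cmul[OF has_derivative_linear[OF D[OF that]], of t w] by simp
  let ?F = "\<lambda>p. f (x + p *\<^sub>R u + r *\<^sub>R v) - f (x + p *\<^sub>R u)"
  have "\<exists>p>0. p < r \<and> ?F r - ?F 0 = (r - 0) *
      (ddir S u f (x + p *\<^sub>R u + r *\<^sub>R v) - ddir S u f (x + p *\<^sub>R u))"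
  proof (rule MVT2[OF r])
    fix p assume p: "0 \<le> p" "p \<le> r"
    have in1: "x + p *\<^sub>R u + r *\<^sub>R v \<in> S" and in2: "x + p *\<^sub>R u \<in> S"
      using box[OF p, of r] box[OF p, of 0] r by auto
    have "((\<lambda>p. f (x + p *\<^sub>R u + r *\<^sub>R v))
        has_derivative (\<lambda>t. ddir S (t *\<^sub>R u) f (x + p *\<^sub>R u + r *\<^sub>R v))) (at p)"
      by (rule has_derivative_compose[where g=f
        and f="\<lambda>p. x + p *\<^sub>R u + r *\<^sub>R v", OF _ D[OF f in1]])
        (auto intro!: derivative_eq_intros)
    moreover have "((\<lambda>p. f (x + p *\<^sub>R u)) has_derivative (\<lambda>t. ddir S (t *\<^sub>R u) f (x + p *\<^sub>R u)))
        (at p)"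
      by (rule has_derivative_compose[where g=f and f="\<lambda>p. x + p *\<^sub>R u", OF _ D[OF f in2]])
        (auto intro!: derivative_eq_intros)
    ultimately have "(?F has_derivative
        (\<lambda>t. ddir S (t *\<^sub>R u) f (x + p *\<^sub>R u + r *\<^sub>R v) - ddir S (t *\<^sub>R u) f (x + p *\<^sub>R u))) (at p)"
      by (rule has_derivative_diff)
    then show "(?F has_real_derivative ddir S u f (x + p *\<^sub>R u + r *\<^sub>R v)
        - ddir S u f (x + p *\<^sub>R u)) (at p)"
      unfolding has_field_derivative_def
      by (rule has_derivative_eq_rhs)
        (simp add: fun_eq_iff lin[OF f in1] lin[OF f in2] right_diff_distrib mult.commute)
  qed
  then obtain p where p: "0 < p" "p < r"
    and eq1: "?F r - ?F 0 = r * (ddir S u f (x + p *\<^sub>R u + r *\<^sub>R v) - ddir S u f (x + p *\<^sub>R u))"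
    by auto
  let ?G = "\<lambda>q. ddir S u f (x + p *\<^sub>R u + q *\<^sub>R v)"
  have "\<exists>q>0. q < r \<and> ?G r - ?G 0 = (r - 0) * ddir S v (ddir S u f) (x + p *\<^sub>R u + q *\<^sub>R v)"
  proof (rule MVT2[OF r])
    fix q assume q: "0 \<le> q" "q \<le> r"
    have in1: "x + p *\<^sub>R u + q *\<^sub>R v \<in> S"
      using box[of p q] p q by auto
    have "(?G has_derivative (\<lambda>t. ddir S (t *\<^sub>R v) (ddir S u f) (x + p *\<^sub>R u + q *\<^sub>R v))) (at q)"
      by (rule has_derivative_compose[where g="ddir S u f"
        and f="\<lambda>q. x + p *\<^sub>R u + q *\<^sub>R v", OF _ D[OF sm in1]])
        (auto intro!: derivative_eq_intros)
    then show "(?G has_real_derivative ddir S v (ddir S u f) (x + p *\<^sub>R u + q *\<^sub>R v)) (at q)"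
      unfolding has_field_derivative_def
        by (simp add: lin[OF sm in1] mult.commute[of _ "ddir S _ _ _"])
  qed
  then obtain q where q: "0 < q" "q < r"
    and eq2: "?G r - ?G 0 = r * ddir S v (ddir S u f) (x + p *\<^sub>R u + q *\<^sub>R v)" by auto
  show ?thesis
    by (rule that[of p q]) (use p q eq1 eq2 in \<open>auto simp: algebra_simps\<close>)
qed

text \<open>
  Two applications of the preceding mean value identity, with \<open>u\<close> and \<open>v\<close> exchanged, represent the
  same second difference; letting \<open>r \<rightarrow> 0\<close> moves both intermediate points to \<open>x\<close>.
\<close>

lemma ddir_commute_interior_real:
  fixes f :: "'a::euclidean_space \<Rightarrow> real"
  assumes f: "smooth_on S f" and S: "open S" and x: "x \<in> S"
  shows "ddir S v (ddir S u f) x = ddir S u (ddir S v f) x"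
proof -
  note dom = deriv_domain_open[OF S]
  obtain e where e: "e > 0" "ball x e \<subseteq> S" using S x open_contains_ball by blast
  define K where "K = norm u + norm v + 1"
  have K: "K > 0" unfolding K_def by (simp add: add_nonneg_pos)
  define r :: "nat \<Rightarrow> real" where "r n = e / (2 * K) / (real n + 1)" for n
  \<comment> \<open>\<open>r n\<close> is so small that the parallelogram with sides \<open>r n u\<close> and \<open>r n v\<close> stays inside
      \<open>ball x e\<close>.\<close>
  have r0: "r n > 0" for n using e K by (simp add: r_def)
  have r_le: "r n \<le> e / (2 * K)" for n
    unfolding r_def using e K by (simp add: divide_le_eq mult_left_mono)
  have r_lim: "r \<longlonglongrightarrow> 0"
  proof -
    have "(\<lambda>n. e / (2 * K) * (1 / (real n + 1))) \<longlonglongrightarrow> e / (2 * K) * 0"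
      by (intro tendsto_mult tendsto_const
        LIMSEQ_inverse_real_of_nat[unfolded inverse_eq_divide, THEN Lim_transform_eventually])
            (auto simp: add.commute)
    then show ?thesis by (simp add: r_def[abs_def])
  qed
  have near: "norm (p *\<^sub>R a + q *\<^sub>R b) \<le> r n * K"
    if "0 \<le> p" "p \<le> r n" "0 \<le> q" "q \<le> r n" "norm a + norm b \<le> K" for p q n and a b :: 'a
  proof -
    have "norm (p *\<^sub>R a + q *\<^sub>R b) \<le> p * norm a + q * norm b"
      using that by (metis abs_of_nonneg norm_scaleR norm_triangle_ineq)
    also have "\<dots> \<le> r n * norm a + r n * norm b"
      using that by (intro add_mono mult_right_mono) auto
    also have "\<dots> = r n * (norm a + norm b)" by (simp add: algebra_simps)
    also have "\<dots> \<le> r n * K" using r0[of n] that by (intro mult_left_mono) auto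
    finally show ?thesis .
  qed
  have inS: "x + p *\<^sub>R a + q *\<^sub>R b \<in> S"
    if "0 \<le> p" "p \<le> r n" "0 \<le> q" "q \<le> r n" "norm a + norm b \<le> K" for p q n and a b :: 'a
  proof -
    have "norm (p *\<^sub>R a + q *\<^sub>R b) \<le> e / (2 * K) * K"
      using near[OF that] mult_right_mono[OF r_le[of n], of K] K by linarith
    also have "\<dots> < e" using K e by simp
    finally have "x + p *\<^sub>R a + q *\<^sub>R b \<in> ball x e"
      using norm_minus_cancel[of "p *\<^sub>R a + q *\<^sub>R b"] by (simp add: dist_norm add.assoc)
    then show ?thesis using e by blast
  qed
  have Kuv: "norm u + norm v \<le> K" "norm v + norm u \<le> K" by (auto simp: K_def)
  have lim: "(\<lambda>n. ddir S b (ddir S a f) (x + p n *\<^sub>R a + q n *\<^sub>R b)) \<longlonglongrightarrow> ddir S b (ddir S a f) x"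
    if pq: "\<And>n. 0 \<le> p n \<and> p n \<le> r n \<and> 0 \<le> q n \<and> q n \<le> r n" and ab: "norm a + norm b \<le> K"
    for p q :: "nat \<Rightarrow> real" and a b
  proof -
    have "continuous_on S (ddir S b (ddir S a f))"
      by (intro smooth_on_continuous smooth_on_ddir f dom)
    moreover have "(\<lambda>n. x + p n *\<^sub>R a + q n *\<^sub>R b) \<longlonglongrightarrow> x + 0 *\<^sub>R a + 0 *\<^sub>R b"
    proof (intro tendsto_add tendsto_scaleR tendsto_const)
      show "p \<longlonglongrightarrow> 0" by (rule real_tendsto_sandwich[OF _ _ tendsto_const r_lim]) (use pq in auto)
      show "q \<longlonglongrightarrow> 0" by (rule real_tendsto_sandwich[OF _ _ tendsto_const r_lim]) (use pq in auto)
    qed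
    ultimately show ?thesis
      using x S isCont_tendsto_compose[of x "ddir S b (ddir S a f)"]
      by (simp add: continuous_on_eq_continuous_at)
  qed
  let ?\<Delta> = "\<lambda>n. f (x + r n *\<^sub>R u + r n *\<^sub>R v) - f (x + r n *\<^sub>R u) - f (x + r n *\<^sub>R v) + f x"
  have "\<exists>p q. 0 \<le> p \<and> p \<le> r n \<and> 0 \<le> q \<and> q \<le> r n \<and> ?\<Delta> n
      = r n * r n * ddir S v (ddir S u f) (x + p *\<^sub>R u + q *\<^sub>R v)" for n
    using second_difference_mean_value[OF f S r0[of n], of x u v] inS Kuv(1) by metis
  then obtain p q where pq: "\<And>n. 0 \<le> p n \<and> p n \<le> r n \<and> 0 \<le> q n \<and> q n \<le> r n"
    and eq1: "\<And>n. ?\<Delta> n = r n * r n * ddir S v (ddir S u f) (x + p n *\<^sub>R u + q n *\<^sub>R v)" by metis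
  have "\<exists>p q. 0 \<le> p \<and> p \<le> r n \<and> 0 \<le> q \<and> q \<le> r n \<and>
      f (x + r n *\<^sub>R v + r n *\<^sub>R u) - f (x + r n *\<^sub>R v) - f (x + r n *\<^sub>R u) + f x
          = r n * r n * ddir S u (ddir S v f) (x + p *\<^sub>R v + q *\<^sub>R u)" for n
    using second_difference_mean_value[OF f S r0[of n], of x v u] inS Kuv(2) by metis
  then obtain p' q' where pq': "\<And>n. 0 \<le> p' n \<and> p' n \<le> r n \<and> 0 \<le> q' n \<and> q' n \<le> r n"
    and eq2: "\<And>n. f (x + r n *\<^sub>R v + r n *\<^sub>R u) - f (x + r n *\<^sub>R v) - f (x + r n *\<^sub>R u) + f x
        = r n * r n * ddir S u (ddir S v f) (x + p' n *\<^sub>R v + q' n *\<^sub>R u)" by metis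
  have swap: "x + r n *\<^sub>R v + r n *\<^sub>R u = x + r n *\<^sub>R u + r n *\<^sub>R v" for n
    by (simp add: add_ac)
  have "r n * r n * ddir S v (ddir S u f) (x + p n *\<^sub>R u + q n *\<^sub>R v) =
      r n * r n * ddir S u (ddir S v f) (x + p' n *\<^sub>R v + q' n *\<^sub>R u)" for n
    using eq1[of n] eq2[of n] unfolding swap by linarith
  then have "ddir S v (ddir S u f) (x + p n *\<^sub>R u + q n *\<^sub>R v)
      = ddir S u (ddir S v f) (x + p' n *\<^sub>R v + q' n *\<^sub>R u)" for n
    using r0[of n] by (metis less_irrefl mult_cancel_left mult_eq_0_iff)
  with lim[OF pq Kuv(1)] lim[OF pq' Kuv(2)] show ?thesis
    using LIMSEQ_unique by simp
qed

lemma ddir_compose_bounded_linear: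
  assumes f: "smooth_on S f" and S: "deriv_domain S" and x: "x \<in> S" and L: "bounded_linear L"
  shows "ddir S u (\<lambda>z. L (f z)) x = L (ddir S u f x)"
  by (rule ddir_eq[OF bounded_linear.has_derivative[OF L smooth_on_has_derivative[OF f S x]] S x])

lemma ddir_cong: "(\<And>z. z \<in> S \<Longrightarrow> f z = h z) \<Longrightarrow> x \<in> S \<Longrightarrow> ddir S u f x = ddir S u h x"
  by (rule ddir_cong_Int_open[of UNIV]) auto

text \<open>
  In the interior this is the symmetry of second derivatives. Both sides are continuous on \<open>S\<close> and
  the interior is dense, so the identity extends to boundary points such as the end points of the
  curves in a variation.
\<close>

lemma ddir_commute:
  fixes f :: "'a::euclidean_space \<Rightarrow> 'b::euclidean_space"
  assumes f: "smooth_on S f" and S: "deriv_domain S" and x: "x \<in> S"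
  shows "ddir S v (ddir S u f) x = ddir S u (ddir S v f) x"
proof (rule euclidean_eqI)
  fix b :: 'b assume "b \<in> Basis"
  define h where "h = (\<lambda>z. f z \<bullet> b)"
  have h: "smooth_on S h" unfolding h_def by (rule smooth_on_inner_const[OF f])
  let ?I = "interior S"
  have sub: "?I \<subseteq> S" by (rule interior_subset)
  have dd: "ddir S v (ddir S u h) z = ddir ?I v (ddir ?I u h) z" if "z \<in> ?I" for u v z
  proof -
    have "ddir S v (ddir S u h) z = ddir (S \<inter> ?I) v (ddir S u h) z"
      using that by (simp add: ddir_Int_open)
    also have "S \<inter> ?I = ?I" using sub by auto
    also have "ddir ?I v (ddir S u h) z = ddir ?I v (ddir ?I u h) z"
    proof (rule ddir_cong[OF _ that])
      fix w assume "w \<in> ?I"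
      then show "ddir S u h w = ddir ?I u h w"
        using ddir_Int_open[of ?I w S u h] sub by (simp add: Int_absorb1)
    qed
    finally show ?thesis .
  qed
  let ?d = "\<lambda>z. ddir S v (ddir S u h) z - ddir S u (ddir S v h) z"
  have cont: "continuous_on S ?d"
    by (intro continuous_intros smooth_on_continuous smooth_on_ddir h S)
  have zero: "?d z = 0" if "z \<in> ?I" for z
    using dd[OF that] ddir_commute_interior_real[OF smooth_on_subset[OF h sub] open_interior that,
      of v u] by simp
  obtain T where T: "closed T" "S \<inter> ?d -` {0} = S \<inter> T"
    using continuous_closedin_preimage[OF cont closed_singleton[of 0]] unfolding closedin_closed
      by auto
  have "?I \<subseteq> T" using zero sub T by blast
  then have "S \<subseteq> T" using closure_minimal[OF _ T(1)] S unfolding deriv_domain_def by blast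
  then have "?d x = 0" using T x by blast
  moreover have "ddir S v (ddir S u h) x = ddir S v (ddir S u f) x \<bullet> b" for u v
  proof -
    have "ddir S v (ddir S u h) x = ddir S v (\<lambda>z. ddir S u f z \<bullet> b) x"
      by (rule ddir_cong[OF _ x]) (simp add: h_def
        ddir_compose_bounded_linear[OF f S _ bounded_linear_inner_left])
    also have "\<dots> = ddir S v (ddir S u f) x \<bullet> b"
      by (rule ddir_compose_bounded_linear[OF smooth_on_ddir[OF f S] S x bounded_linear_inner_left])
    finally show ?thesis .
  qed
  ultimately show "ddir S v (ddir S u f) x \<bullet> b = ddir S u (ddir S v f) x \<bullet> b" by simp
qed


section \<open>Smooth families of bilinear maps\<close>

text \<open>
  A family of bilinear maps is handled through its coefficient functions in the standard basis.
  Differentiating such a family along curves then produces another \<open>bil\<close>, with the differentiated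
  coefficients.
\<close>

definition bil :: "('e::euclidean_space \<Rightarrow> 'e \<Rightarrow> 'x \<Rightarrow> 'b::real_vector) \<Rightarrow> 'e \<Rightarrow> 'e \<Rightarrow> 'x \<Rightarrow> 'b" where
  "bil C u w x = (\<Sum>i\<in>Basis. \<Sum>j\<in>Basis. (u \<bullet> i) *\<^sub>R (w \<bullet> j) *\<^sub>R C i j x)"

lemma bil_add_right: "bil C u (w + w') x = bil C u w x + bil C u w' x"
  by (simp add: bil_def inner_add_left scaleR_add_left scaleR_add_right sum.distrib del:
    scaleR_scaleR)

lemma bil_scaleR_right: "bil C u (r *\<^sub>R w) x = r *\<^sub>R bil C u w x"
  by (simp add: bil_def scaleR_sum_right mult_ac)

lemma bil_diff_left: "bil C (u - u') w x = bil C u w x - bil C u' w x"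
  by (simp add: bil_def inner_diff_left scaleR_diff_left sum_subtractf del: scaleR_scaleR)

lemma bilinear_eq_bil:
  fixes B :: "'e::euclidean_space \<Rightarrow> 'e \<Rightarrow> 'b::real_vector"
  assumes "bilinear B"
  shows "B u w = (\<Sum>i\<in>Basis. \<Sum>j\<in>Basis. (u \<bullet> i) *\<^sub>R (w \<bullet> j) *\<^sub>R B i j)"
proof -
  have l: "linear (\<lambda>u. B u w)" and r: "linear (B u)" for u w
    using assms by (auto simp: bilinear_def)
  have expand: "B i w = (\<Sum>j\<in>Basis. (w \<bullet> j) *\<^sub>R B i j)" for i
  proof -
    have "B i w = B i (\<Sum>j\<in>Basis. (w \<bullet> j) *\<^sub>R j)" by (simp add: euclidean_representation)
    then show ?thesis by (simp add: linear_sum[OF r] linear_cmul[OF r])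
  qed
  have "B u w = B (\<Sum>i\<in>Basis. (u \<bullet> i) *\<^sub>R i) w" by (simp add: euclidean_representation)
  also have "\<dots> = (\<Sum>i\<in>Basis. (u \<bullet> i) *\<^sub>R B i w)"
    by (simp add: linear_sum[OF l] linear_cmul[OF l])
  also have "\<dots> = (\<Sum>i\<in>Basis. \<Sum>j\<in>Basis. (u \<bullet> i) *\<^sub>R (w \<bullet> j) *\<^sub>R B i j)"
    by (subst expand) (simp add: scaleR_sum_right)
  finally show ?thesis .
qed

lemma has_derivative_bil:
  fixes C :: "'e::euclidean_space \<Rightarrow> 'e \<Rightarrow> 'x::real_normed_vector \<Rightarrow> 'b::real_normed_vector"
  assumes "\<And>i j. i \<in> Basis \<Longrightarrow> j \<in> Basis \<Longrightarrow> (C i j has_derivative C' i j) (at y within S)"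
    and U: "(U has_derivative U') (at y within S)" and W: "(W has_derivative W') (at y within S)"
  shows "((\<lambda>z. bil C (U z) (W z) z) has_derivative
     (\<lambda>h. bil C' (U y) (W y) h + bil C (U' h) (W y) y + bil C (U y) (W' h) y)) (at y within S)"
  unfolding bil_def
  by (rule has_derivative_eq_rhs,
      (rule has_derivative_sum has_derivative_scaleR has_derivative_inner_left assms | assumption)+)
    (simp add: sum.distrib[symmetric] scaleR_add_right add_ac del: scaleR_scaleR)

lemma smooth_on_bil:
  assumes "\<And>i j. i \<in> Basis \<Longrightarrow> j \<in> Basis \<Longrightarrow> smooth_on S (C i j)"
    and "smooth_on S U" and "smooth_on S W"
  shows "smooth_on S (\<lambda>z. bil C (U z) (W z) z)"
  unfolding bil_def by (intro smooth_on_sum smooth_on_scaleR smooth_on_inner_const assms) auto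


section \<open>Charts, vector fields and coordinates\<close>

text \<open>
  The change of components of a tangent vector at \<open>p\<close> from chart \<open>c\<close> to chart \<open>d\<close>.
\<close>

definition tchange :: "('m, 'e::euclidean_space) chart \<Rightarrow> ('m, 'e) chart \<Rightarrow> 'm \<Rightarrow> 'e \<Rightarrow> 'e" where
  "tchange c d p = frechet_derivative (transition c d) (at (snd c p))"

lemma tcoord_eq_tchange: "tcoord A c p = tchange (chart_at A p) c p"
  by (simp add: fun_eq_iff tcoord_def tchange_def)

lemma tvec_eq_tchange: "tvec A c p = tchange c (chart_at A p) p"
  by (simp add: fun_eq_iff tvec_def tchange_def)

locale smooth_manifold =
  fixes A :: "('m::{t2_space, second_countable_topology}, 'e::euclidean_space) chart set"
  assumes atlas: "smooth_atlas A"
begin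

lemma chart_at_in [simp]: "chart_at A p \<in> A" and in_chart_at [simp]: "p \<in> fst (chart_at A p)"
proof -
  have "\<exists>c. c \<in> A \<and> p \<in> fst c" using atlas unfolding smooth_atlas_def by blast
  from someI_ex[OF this] show "chart_at A p \<in> A" "p \<in> fst (chart_at A p)"
    by (auto simp: chart_at_def)
qed

lemma chart_homeomorphism:
  "c \<in> A \<Longrightarrow> homeomorphism (fst c) (snd c ` fst c) (snd c) (chart_inv c)"
  using atlas unfolding smooth_atlas_def is_chart_def by blast

lemma open_chart_domain: "c \<in> A \<Longrightarrow> open (fst c)"
  using atlas unfolding smooth_atlas_def is_chart_def by blast

lemma open_chart_range: "c \<in> A \<Longrightarrow> open (snd c ` fst c)"
  using atlas unfolding smooth_atlas_def is_chart_def by blast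

lemma open_chart_image:
  assumes "c \<in> A" "open U" shows "open (snd c ` (fst c \<inter> U))"
proof -
  have "openin (top_of_set (snd c ` fst c)) (snd c ` (fst c \<inter> U))"
    by (rule homeomorphism_imp_open_map[OF chart_homeomorphism[OF assms(1)]])
      (use assms(2) in \<open>auto simp: openin_open\<close>)
  then show ?thesis using open_chart_range[OF assms(1)] openin_open_trans by blast
qed

lemma chart_inv_chart [simp]: "c \<in> A \<Longrightarrow> p \<in> fst c \<Longrightarrow> chart_inv c (snd c p) = p"
  using chart_homeomorphism homeomorphism_apply1 by blast

lemma open_chart_preimage:
  assumes "c \<in> A" "open V" shows "open (fst c \<inter> snd c -` V)"
  using chart_homeomorphism[OF assms(1)] open_chart_domain[OF assms(1)] assms(2)
  by (simp add: continuous_open_preimage homeomorphism_def)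

lemma smooth_on_transition:
  "c \<in> A \<Longrightarrow> d \<in> A \<Longrightarrow> smooth_on (snd c ` (fst c \<inter> fst d)) (transition c d)"
  using atlas unfolding smooth_atlas_def by blast

lemma transition_chart [simp]: "c \<in> A \<Longrightarrow> p \<in> fst c \<Longrightarrow> transition c d (snd c p) = snd d p"
  by (simp add: transition_def)

lemma transition_has_derivative:
  assumes "c \<in> A" "d \<in> A" "p \<in> fst c" "p \<in> fst d"
  shows "(transition c d has_derivative tchange c d p) (at (snd c p))"
proof -
  let ?O = "snd c ` (fst c \<inter> fst d)"
  have O: "open ?O" using assms open_chart_image open_chart_domain by blast
  have p: "snd c p \<in> ?O" using assms by blast
  have "(transition c d has_derivative (\<lambda>u. ddir ?O u (transition c d) (snd c p)))
      (at (snd c p) within ?O)"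
    using assms O p by (intro smooth_on_has_derivative smooth_on_transition deriv_domain_open) auto
  then have "(transition c d has_derivative (\<lambda>u. ddir ?O u (transition c d) (snd c p)))
      (at (snd c p))"
    by (simp add: at_within_open[OF p O])
  then show ?thesis
    unfolding tchange_def using differentiable_def frechet_derivative_works by blast
qed

lemma linear_tchange: "c \<in> A \<Longrightarrow> d \<in> A \<Longrightarrow> p \<in> fst c \<Longrightarrow> p \<in> fst d \<Longrightarrow> linear (tchange c d p)"
  using transition_has_derivative has_derivative_linear by blast

text \<open>
  The cocycle rule, which is the chain rule for the transition maps.
\<close>

lemma tchange_tchange:
  assumes "c \<in> A" "d \<in> A" "k \<in> A" "p \<in> fst c" "p \<in> fst d" "p \<in> fst k"
  shows "tchange d k p (tchange c d p v) = tchange c k p v"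
proof -
  let ?O = "snd c ` (fst c \<inter> (fst d \<inter> fst k))"
  have O: "open ?O" using assms open_chart_domain by (intro open_chart_image open_Int) auto
  have "((\<lambda>x. transition d k (transition c d x))
      has_derivative (\<lambda>v. tchange d k p (tchange c d p v))) (at (snd c p))"
  proof (rule has_derivative_compose[where g = "transition d k" and g' = "tchange d k p"])
    show "(transition d k has_derivative tchange d k p) (at (transition c d (snd c p)))"
      using assms transition_has_derivative[of d k p] by simp
  qed (use assms transition_has_derivative in auto)
  then have "(transition c k has_derivative (\<lambda>v. tchange d k p (tchange c d p v))) (at (snd c p))"
    by (rule has_derivative_transform_within_open[OF _ O]) (use assms in auto)
  then have "(\<lambda>v. tchange d k p (tchange c d p v)) = tchange c k p"
    by (rule has_derivative_unique) (use assms in \<open>auto intro: transition_has_derivative\<close>)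
  from fun_cong[OF this, of v] show ?thesis .
qed

lemma tchange_self: "c \<in> A \<Longrightarrow> p \<in> fst c \<Longrightarrow> tchange c c p v = v"
proof -
  assume c: "c \<in> A" "p \<in> fst c"
  have "(transition c c has_derivative (\<lambda>v. v)) (at (snd c p))"
    by (rule has_derivative_transform_within_open[OF
      has_derivative_ident open_chart_range[OF c(1)]])
      (use c in auto)
  then have "(\<lambda>v. v) = tchange c c p"
    by (rule has_derivative_unique) (use c in \<open>auto intro: transition_has_derivative\<close>)
  from fun_cong[OF this, of v] show ?thesis by simp
qed

lemma linear_tcoord: "c \<in> A \<Longrightarrow> p \<in> fst c \<Longrightarrow> linear (tcoord A c p)"
  by (simp add: tcoord_eq_tchange linear_tchange)

lemma linear_tvec: "c \<in> A \<Longrightarrow> p \<in> fst c \<Longrightarrow> linear (tvec A c p)"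
  by (simp add: tvec_eq_tchange linear_tchange)

lemma tcoord_tvec [simp]: "c \<in> A \<Longrightarrow> p \<in> fst c \<Longrightarrow> tcoord A c p (tvec A c p u) = u"
  by (simp add: tcoord_eq_tchange tvec_eq_tchange tchange_tchange tchange_self)

lemma tvec_tcoord [simp]: "c \<in> A \<Longrightarrow> p \<in> fst c \<Longrightarrow> tvec A c p (tcoord A c p u) = u"
  by (simp add: tcoord_eq_tchange tvec_eq_tchange tchange_tchange tchange_self)

lemma tcoord_chart_at [simp]: "tcoord A (chart_at A p) p v = v"
  by (simp add: tcoord_eq_tchange tchange_self)

lemma tvec_chart_at [simp]: "tvec A (chart_at A p) p v = v"
  by (simp add: tvec_eq_tchange tchange_self)

lemma tchange_tcoord:
  "c \<in> A \<Longrightarrow> d \<in> A \<Longrightarrow> p \<in> fst c \<Longrightarrow> p \<in> fst d \<Longrightarrow> tchange c d p (tcoord A c p v) = tcoord A d p v"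
  by (simp add: tcoord_eq_tchange tchange_tchange)

lemma vector_expand_frame:
  assumes "c \<in> A" "p \<in> fst c"
  shows "v = (\<Sum>b\<in>Basis. (tcoord A c p v \<bullet> b) *\<^sub>R tvec A c p b)"
proof -
  have "v = tvec A c p (\<Sum>b\<in>Basis. (tcoord A c p v \<bullet> b) *\<^sub>R b)"
    using assms by (simp add: euclidean_representation)
  also have "\<dots> = (\<Sum>b\<in>Basis. (tcoord A c p v \<bullet> b) *\<^sub>R tvec A c p b)"
    using linear_tvec[OF assms] by (simp add: linear_sum linear_cmul)
  finally show ?thesis .
qed

lemma field_coord_chart [simp]:
  "c \<in> A \<Longrightarrow> p \<in> fst c \<Longrightarrow> field_coord A c X (snd c p) = tcoord A c p (X p)"
  by (simp add: field_coord_def)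

text \<open>
  Smoothness near \<open>p\<close> asks for smooth components in all charts at once. Since the transition maps
  are smooth, one chart around \<open>p\<close> suffices.
\<close>

lemma vector_field_near_iff:
  assumes c: "c \<in> A" "p \<in> fst c"
  shows "vector_field_near A p X \<longleftrightarrow>
    (\<exists>V. open V \<and> snd c p \<in> V \<and> V \<subseteq> snd c ` fst c \<and> smooth_on V (field_coord A c X))"
proof
  assume "vector_field_near A p X"
  then obtain U where U: "open U" "p \<in> U" "smooth_on (snd c ` (fst c \<inter> U)) (field_coord A c X)"
    unfolding vector_field_near_def using c by blast
  then show "\<exists>V. open V \<and> snd c p \<in> V \<and> V \<subseteq> snd c ` fst c \<and> smooth_on V (field_coord A c X)"
    using c open_chart_image by (intro exI[of _ "snd c ` (fst c \<inter> U)"]) auto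
next
  assume "\<exists>V. open V \<and> snd c p \<in> V \<and> V \<subseteq> snd c ` fst c \<and> smooth_on V (field_coord A c X)"
  then obtain V where V: "open V" "snd c p \<in> V" "V \<subseteq> snd c ` fst c"
      "smooth_on V (field_coord A c X)"
    by blast
  define U where "U = fst c \<inter> snd c -` V"
  have U: "open U" "p \<in> U" unfolding U_def using V c open_chart_preimage by auto
  have "smooth_on (snd d ` (fst d \<inter> U)) (field_coord A d X)" if d: "d \<in> A" for d
  proof -
    let ?N = "snd d ` (fst d \<inter> U)"
    have sub: "?N \<subseteq> snd d ` (fst d \<inter> fst c)" by (auto simp: U_def)
    have tr: "smooth_on ?N (transition d c)"
      using smooth_on_subset[OF smooth_on_transition sub] d c by auto
    have trV: "transition d c ` ?N \<subseteq> V" using d by (auto simp: U_def)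
    have trW: "transition d c ` ?N \<subseteq> snd c ` (fst c \<inter> fst d)" using d by (auto simp: U_def)
    have opn: "deriv_domain (snd c ` (fst c \<inter> fst d))"
      by (intro deriv_domain_open open_chart_image open_chart_domain c d)
    have M: "smooth_on ?N (\<lambda>x. ddir (snd c ` (fst c \<inter> fst d)) b (transition c d)
        (transition d c x))" for b
      by (rule smooth_on_compose[OF smooth_on_ddir[OF smooth_on_transition opn] tr trW])
        (use c d in auto)
    have X: "smooth_on ?N (\<lambda>x. field_coord A c X (transition d c x))"
      by (rule smooth_on_compose[OF V(4) tr trV])
    have "smooth_on ?N (\<lambda>x. \<Sum>b\<in>Basis. (field_coord A c X (transition d c x) \<bullet> b) *\<^sub>R
        ddir (snd c ` (fst c \<inter> fst d)) b (transition c d) (transition d c x))"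
      by (intro smooth_on_sum smooth_on_scaleR smooth_on_inner_const M X) auto
    also have "?this \<longleftrightarrow> ?thesis"
    proof (rule smooth_on_cong)
      fix x assume "x \<in> ?N"
      then obtain q where q: "x = snd d q" "q \<in> fst d" "q \<in> U" by auto
      then have qc: "q \<in> fst c" by (simp add: U_def)
      have "(transition c d has_derivative tchange c d q)
          (at (snd c q) within snd c ` (fst c \<inter> fst d))"
        using transition_has_derivative[OF c(1) d qc q(2)] has_derivative_at_withinI by blast
      from ddir_eq[OF this opn] q qc
      have *: "ddir (snd c ` (fst c \<inter> fst d)) b (transition c d) (snd c q) = tchange c d q b" for b
        by blast
      have "(\<Sum>b\<in>Basis. (tcoord A c q (X q) \<bullet> b) *\<^sub>R tchange c d q b)
          = tchange c d q (\<Sum>b\<in>Basis. (tcoord A c q (X q) \<bullet> b) *\<^sub>R b)"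
        using linear_tchange[OF c(1) d qc q(2)] by (simp add: linear_sum linear_cmul)
      also have "\<dots> = tcoord A d q (X q)"
        using c d q qc by (simp add: euclidean_representation tchange_tcoord)
      finally show "(\<Sum>b\<in>Basis. (field_coord A c X (transition d c x) \<bullet> b) *\<^sub>R
        ddir (snd c ` (fst c \<inter> fst d)) b (transition c d) (transition d c x)) = field_coord A d X x"
        using q qc c d by (simp add: *)
    qed
    finally show ?thesis .
  qed
  then show "vector_field_near A p X" unfolding vector_field_near_def using U by blast
qed

lemma smooth_near_iff:
  assumes c: "c \<in> A" "p \<in> fst c"
  shows "smooth_near A p f \<longleftrightarrow>
    (\<exists>V. open V \<and> snd c p \<in> V \<and> V \<subseteq> snd c ` fst c \<and> smooth_on V (\<lambda>x. f (chart_inv c x)))"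
proof
  assume "smooth_near A p f"
  then obtain U where U: "open U" "p \<in> U" "smooth_on (snd c ` (fst c \<inter> U)) (\<lambda>x. f (chart_inv c x))"
    unfolding smooth_near_def using c by blast
  then show "\<exists>V. open V \<and> snd c p \<in> V \<and> V \<subseteq> snd c ` fst c \<and> smooth_on V (\<lambda>x. f (chart_inv c x))"
    using c open_chart_image by (intro exI[of _ "snd c ` (fst c \<inter> U)"]) auto
next
  assume "\<exists>V. open V \<and> snd c p \<in> V \<and> V \<subseteq> snd c ` fst c \<and> smooth_on V (\<lambda>x. f (chart_inv c x))"
  then obtain V where V: "open V" "snd c p \<in> V" "V \<subseteq> snd c ` fst c"
      "smooth_on V (\<lambda>x. f (chart_inv c x))"
    by blast
  define U where "U = fst c \<inter> snd c -` V"
  have U: "open U" "p \<in> U" unfolding U_def using V c open_chart_preimage by auto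
  have "smooth_on (snd d ` (fst d \<inter> U)) (\<lambda>x. f (chart_inv d x))" if d: "d \<in> A" for d
  proof -
    let ?N = "snd d ` (fst d \<inter> U)"
    have sub: "?N \<subseteq> snd d ` (fst d \<inter> fst c)" by (auto simp: U_def)
    have tr: "smooth_on ?N (transition d c)"
      using smooth_on_subset[OF smooth_on_transition sub] d c by auto
    have trV: "transition d c ` ?N \<subseteq> V" using d by (auto simp: U_def)
    have "smooth_on ?N (\<lambda>x. f (chart_inv c (transition d c x)))"
      by (rule smooth_on_compose[OF V(4) tr trV])
    also have "?this \<longleftrightarrow> ?thesis"
      by (rule smooth_on_cong) (use c d in \<open>auto simp: U_def\<close>)
    finally show ?thesis .
  qed
  then show "smooth_near A p f" unfolding smooth_near_def using U by blast
qed

lemma field_coord_has_derivative: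
  assumes "vector_field_near A p X" "c \<in> A" "p \<in> fst c"
  shows "(field_coord A c X has_derivative (\<lambda>u. ddir UNIV u (field_coord A c X) (snd c p)))
      (at (snd c p))"
proof -
  obtain V where V: "open V" "snd c p \<in> V" "smooth_on V (field_coord A c X)"
    using assms vector_field_near_iff by blast
  from smooth_on_has_derivative[OF V(3) deriv_domain_open[OF V(1)] V(2)]
  show ?thesis
    by (simp add: at_within_open[OF V(2,1)] ddir_Int_open[OF V(1,2), of UNIV, simplified])
qed

lemma smooth_near_has_derivative:
  assumes "smooth_near A p f" "c \<in> A" "p \<in> fst c"
  shows "((\<lambda>x. f (chart_inv c x)) has_derivative
      (\<lambda>u. ddir UNIV u (\<lambda>x. f (chart_inv c x)) (snd c p))) (at (snd c p))"
proof -
  obtain V where V: "open V" "snd c p \<in> V" "smooth_on V (\<lambda>x. f (chart_inv c x))"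
    using assms smooth_near_iff by blast
  from smooth_on_has_derivative[OF V(3) deriv_domain_open[OF V(1)] V(2)]
  show ?thesis
    by (simp add: at_within_open[OF V(2,1)] ddir_Int_open[OF V(1,2), of UNIV, simplified])
qed

lemma dir_deriv_chart:
  assumes c: "c \<in> A" "p \<in> fst c"
    and D: "((\<lambda>x. f (chart_inv c x)) has_derivative F') (at (snd c p))"
  shows "dir_deriv A p v f = F' (tcoord A c p v)"
proof -
  let ?d = "chart_at A p"
  let ?O = "snd ?d ` (fst ?d \<inter> fst c)"
  have O: "open ?O" using c open_chart_image open_chart_domain by auto
  have "((\<lambda>x. f (chart_inv c (transition ?d c x))) has_derivative (\<lambda>v. F' (tchange ?d c p v)))
      (at (snd ?d p))"
  proof (rule has_derivative_compose[where g = "\<lambda>x. f (chart_inv c x)" and g' = F'])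
    show "(transition ?d c has_derivative tchange ?d c p) (at (snd ?d p))"
      using c transition_has_derivative[of ?d c p] by simp
  qed (use c D in simp)
  then have "((\<lambda>x. f (chart_inv ?d x)) has_derivative (\<lambda>v. F' (tchange ?d c p v))) (at (snd ?d p))"
    by (rule has_derivative_transform_within_open[OF _ O]) (use c in auto)
  from frechet_derivative_at[OF this] show ?thesis
    unfolding dir_deriv_def tcoord_eq_tchange by (simp add: fun_eq_iff)
qed

text \<open>
  Constant components are smooth. For \<open>u \<in> Basis\<close> these are the coordinate fields, the local frame
  in which other fields are expanded.
\<close>

lemma frame_field:
  assumes c: "c \<in> A" "p \<in> fst c"
  shows "vector_field_near A p (\<lambda>q. tvec A c q u)"
proof -
  have "smooth_on (snd c ` fst c) (field_coord A c (\<lambda>q. tvec A c q u))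
      \<longleftrightarrow> smooth_on (snd c ` fst c) (\<lambda>x. u)"
    by (rule smooth_on_cong) (use c in auto)
  then show ?thesis using c open_chart_range smooth_on_const
    unfolding vector_field_near_iff[OF c] by blast
qed

lemma extend_field: "vector_field_near A p (extend A p v)"
  and extend_at [simp]: "extend A p v p = v"
proof -
  have "\<exists>X. vector_field_near A p X \<and> X p = v"
    using frame_field[of "chart_at A p" p v]
      by (intro exI[of _ "\<lambda>q. tvec A (chart_at A p) q v"]) auto
  from someI_ex[OF this] show "vector_field_near A p (extend A p v)" "extend A p v p = v"
    by (auto simp: extend_def)
qed

lemma field_add:
  assumes "vector_field_near A p X" "vector_field_near A p Y"
  shows "vector_field_near A p (\<lambda>q. X q + Y q)"
proof -
  let ?c = "chart_at A p"
  obtain V where V: "open V" "snd ?c p \<in> V" "V \<subseteq> snd ?c ` fst ?c" "smooth_on V (field_coord A ?c X)"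
    using assms(1) unfolding vector_field_near_iff[OF chart_at_in in_chart_at] by blast
  obtain V' where V': "open V'" "snd ?c p \<in> V'" "V' \<subseteq> snd ?c ` fst ?c"
      "smooth_on V' (field_coord A ?c Y)"
    using assms(2) unfolding vector_field_near_iff[OF chart_at_in in_chart_at] by blast
  have "smooth_on (V \<inter> V') (\<lambda>x. field_coord A ?c X x + field_coord A ?c Y x)"
    by (intro smooth_on_add smooth_on_subset[OF V(4)] smooth_on_subset[OF V'(4)]) auto
  also have "?this \<longleftrightarrow> smooth_on (V \<inter> V') (field_coord A ?c (\<lambda>q. X q + Y q))"
    by (rule smooth_on_cong) (use V(3) linear_add[OF linear_tcoord[OF chart_at_in]] in
      \<open>auto simp: field_coord_def\<close>)
  finally show ?thesis
    unfolding vector_field_near_iff[OF chart_at_in in_chart_at] using V V'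
    by (intro exI[of _ "V \<inter> V'"]) auto
qed

lemma field_scaleR:
  assumes "smooth_near A p f" "vector_field_near A p Y"
  shows "vector_field_near A p (\<lambda>q. f q *\<^sub>R Y q)"
proof -
  let ?c = "chart_at A p"
  obtain V where V: "open V" "snd ?c p \<in> V" "V \<subseteq> snd ?c ` fst ?c"
      "smooth_on V (\<lambda>x. f (chart_inv ?c x))"
    using assms(1) unfolding smooth_near_iff[OF chart_at_in in_chart_at] by blast
  obtain V' where V': "open V'" "snd ?c p \<in> V'" "V' \<subseteq> snd ?c ` fst ?c"
      "smooth_on V' (field_coord A ?c Y)"
    using assms(2) unfolding vector_field_near_iff[OF chart_at_in in_chart_at] by blast
  have "smooth_on (V \<inter> V') (\<lambda>x. f (chart_inv ?c x) *\<^sub>R field_coord A ?c Y x)"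
    by (intro smooth_on_scaleR smooth_on_subset[OF V(4)] smooth_on_subset[OF V'(4)]) auto
  also have "?this \<longleftrightarrow> smooth_on (V \<inter> V') (field_coord A ?c (\<lambda>q. f q *\<^sub>R Y q))"
    by (rule smooth_on_cong) (use V(3) linear_cmul[OF linear_tcoord[OF chart_at_in]] in
      \<open>auto simp: field_coord_def\<close>)
  finally show ?thesis
    unfolding vector_field_near_iff[OF chart_at_in in_chart_at] using V V'
    by (intro exI[of _ "V \<inter> V'"]) auto
qed

lemma component_smooth_near:
  assumes "vector_field_near A p X" "c \<in> A" "p \<in> fst c"
  shows "smooth_near A p (\<lambda>q. tcoord A c q (X q) \<bullet> b)"
  using assms smooth_on_inner_const
  unfolding vector_field_near_iff[OF assms(2,3)] smooth_near_iff[OF assms(2,3)] field_coord_def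
  by blast

lemma smooth_near_const: "smooth_near A p (\<lambda>q. r)"
  unfolding smooth_near_def using smooth_on_const by blast

lemma field_zero: "vector_field_near A p (\<lambda>q. 0)"
  using field_scaleR[OF smooth_near_const[of p 0] frame_field[OF chart_at_in in_chart_at]] by simp

lemma field_sum:
  "finite I \<Longrightarrow> (\<And>i. i \<in> I \<Longrightarrow> vector_field_near A p (X i)) \<Longrightarrow> vector_field_near A p (\<lambda>q. \<Sum>i\<in>I. X i q)"
  by (induction I rule: finite_induct) (auto intro: field_zero field_add)

end


section \<open>Affine connections in coordinates\<close>

locale affine_conn = smooth_manifold A
  for A :: "('m::{t2_space, second_countable_topology}, 'e::euclidean_space) chart set" +
  fixes D :: "('m, 'e) connection"
  assumes connection: "affine_connection A D"
begin

lemmas D_linear = connection[unfolded affine_connection_def, THEN conjunct1, rule_format]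
lemmas D_add = connection[unfolded affine_connection_def, THEN conjunct2, THEN conjunct1,
    rule_format]
lemmas D_scaleR = connection[unfolded affine_connection_def, THEN conjunct2, THEN conjunct2,
  THEN conjunct1, rule_format]
lemmas D_local = connection[unfolded affine_connection_def, THEN conjunct2, THEN conjunct2,
  THEN conjunct2, THEN conjunct1, rule_format]
lemmas D_field = connection[unfolded affine_connection_def, THEN conjunct2, THEN conjunct2,
  THEN conjunct2, THEN conjunct2, rule_format]

lemma D_zero: "D p v (\<lambda>q. 0) = 0"
  using D_add[OF field_zero field_zero, of p v] by simp

lemma D_sum:
  "finite I \<Longrightarrow> (\<And>i. i \<in> I \<Longrightarrow> vector_field_near A p (X i)) \<Longrightarrow>
    D p v (\<lambda>q. \<Sum>i\<in>I. X i q) = (\<Sum>i\<in>I. D p v (X i))"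
  by (induction I rule: finite_induct) (auto simp: D_zero D_add field_sum)

text \<open>
  The coefficient \<open>chris c i j\<close> is the component vector of \<open>\<nabla>\<^bsub>e\<^sub>i\<^esub> e\<^sub>j\<close> for the coordinate fields
  of \<open>c\<close>: the Christoffel symbols \<open>\<Gamma>\<^sup>k\<^sub>i\<^sub>j\<close>, with the upper index as vector index.
\<close>

definition chris :: "('m, 'e) chart \<Rightarrow> 'e \<Rightarrow> 'e \<Rightarrow> 'e \<Rightarrow> 'e" where
  "chris c i j = field_coord A c (\<lambda>q. D q (tvec A c q i) (\<lambda>q. tvec A c q j))"

lemma smooth_on_chris:
  assumes c: "c \<in> A" shows "smooth_on (snd c ` fst c) (chris c i j)"
proof (rule smooth_on_locally)
  show "deriv_domain (snd c ` fst c)" by (intro deriv_domain_open open_chart_range c)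
next
  fix x assume "x \<in> snd c ` fst c"
  then obtain p where p: "p \<in> fst c" "x = snd c p" by blast
  have "vector_field_near A p (\<lambda>q. D q (tvec A c q i) (\<lambda>q. tvec A c q j))"
    by (rule D_field[OF frame_field[OF c p(1)] frame_field[OF c p(1)]])
  then obtain V where V: "open V" "snd c p \<in> V" "smooth_on V (chris c i j)"
    unfolding vector_field_near_iff[OF c p(1)] chris_def by auto
  then show "\<exists>U. open U \<and> x \<in> U \<and> smooth_on (snd c ` fst c \<inter> U) (chris c i j)"
    by (intro exI[of _ V]) (auto simp: p intro: smooth_on_subset[OF V(3)])
qed

text \<open>
  The last sum is the zeroth-order part of the covariant derivative and of the induced derivative.
\<close>

lemma bil_chris:
  assumes c: "c \<in> A" "p \<in> fst c"
  shows "bil (chris c) (tcoord A c p v) w (snd c p)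
    = (\<Sum>b\<in>Basis. (w \<bullet> b) *\<^sub>R tcoord A c p (D p v (\<lambda>q. tvec A c q b)))"
proof -
  have "D p v Y = (\<Sum>i\<in>Basis. (tcoord A c p v \<bullet> i) *\<^sub>R D p (tvec A c p i) Y)"
    if "vector_field_near A p Y" for Y
    by (subst vector_expand_frame[OF c, of v])
      (simp add: linear_sum[OF D_linear[OF that]] linear_cmul[OF D_linear[OF that]])
  then have "tcoord A c p (D p v (\<lambda>q. tvec A c q b)) =
      (\<Sum>i\<in>Basis. (tcoord A c p v \<bullet> i) *\<^sub>R chris c i b (snd c p))" for b
    using c frame_field[OF c, of b] linear_tcoord[OF c]
    by (simp add: chris_def linear_sum linear_cmul)
  then show ?thesis
    unfolding bil_def by (subst sum.swap) (simp add: scaleR_sum_right mult.commute)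
qed

text \<open>
  The coordinate formula \<open>(D\<^sub>v Y)\<^sup>k = v(Y\<^sup>k) + \<Gamma>\<^sup>k(v, Y)\<close>. Locality allows to replace \<open>Y\<close> by its
  expansion in the coordinate fields, to which additivity and the Leibniz rule apply.
\<close>

lemma connection_coord:
  assumes c: "c \<in> A" "p \<in> fst c" and Y: "vector_field_near A p Y"
  shows "tcoord A c p (D p v Y) = ddir UNIV (tcoord A c p v) (field_coord A c Y) (snd c p)
    + bil (chris c) (tcoord A c p v) (tcoord A c p (Y p)) (snd c p)"
proof -
  let ?Y = "\<lambda>b q. tcoord A c q (Y q) \<bullet> b"
  have ev: "eventually (\<lambda>q. Y q = (\<Sum>b\<in>Basis. ?Y b q *\<^sub>R tvec A c q b)) (nhds p)"
    unfolding eventually_nhds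
    using c open_chart_domain[OF c(1)] vector_expand_frame by (intro exI[of _ "fst c"]) blast
  have sm: "smooth_near A p (?Y b)" for b by (rule component_smooth_near[OF Y c])
  have "D p v Y = D p v (\<lambda>q. \<Sum>b\<in>Basis. ?Y b q *\<^sub>R tvec A c q b)"
    by (rule D_local[OF Y ev])
  also have "\<dots> = (\<Sum>b\<in>Basis. D p v (\<lambda>q. ?Y b q *\<^sub>R tvec A c q b))"
    by (intro D_sum field_scaleR sm frame_field c) auto
  also have "\<dots> = (\<Sum>b\<in>Basis. dir_deriv A p v (?Y b) *\<^sub>R tvec A c p b
      + ?Y b p *\<^sub>R D p v (\<lambda>q. tvec A c q b))"
    by (intro sum.cong D_scaleR sm frame_field c refl)
  finally have eq: "D p v Y = \<dots>" .
  have dir: "dir_deriv A p v (?Y b)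
      = ddir UNIV (tcoord A c p v) (field_coord A c Y) (snd c p) \<bullet> b" for b
  proof (rule dir_deriv_chart[OF c])
    show "((\<lambda>x. ?Y b (chart_inv c x))
        has_derivative (\<lambda>u. ddir UNIV u (field_coord A c Y) (snd c p) \<bullet> b)) (at (snd c p))"
      using has_derivative_inner_left[OF field_coord_has_derivative[OF Y c]]
        by (simp add: field_coord_def[abs_def])
  qed
  show ?thesis
    unfolding eq bil_chris[OF c]
    using linear_tcoord[OF c] c
    by (simp add: linear_sum linear_add linear_cmul sum.distrib dir euclidean_representation)
qed

end


section \<open>Fields along a map and the induced connection\<close>

locale param_map = smooth_manifold A
  for A :: "('m::{t2_space, second_countable_topology}, 'e::euclidean_space) chart set" +
  fixes S :: "'p::euclidean_space set" and f :: "'p \<Rightarrow> 'm"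
  assumes domS: "deriv_domain S" and smooth_f: "smooth_map_on A S f"
begin

text \<open>
  The components of a field along \<open>f\<close> in the chart \<open>c\<close> are tested only where \<open>f\<close> takes values in
  the domain of \<open>c\<close>.
\<close>

definition smooth_along :: "('p \<Rightarrow> 'e) \<Rightarrow> bool" where
  "smooth_along X \<longleftrightarrow> (\<forall>c\<in>A. smooth_on (S \<inter> f -` fst c) (\<lambda>y. tcoord A c (f y) (X y)))"

abbreviation fcoord :: "('m, 'e) chart \<Rightarrow> 'p \<Rightarrow> 'e" where
  "fcoord c \<equiv> \<lambda>y. snd c (f y)"

abbreviation scoord :: "('m, 'e) chart \<Rightarrow> ('p \<Rightarrow> 'e) \<Rightarrow> 'p \<Rightarrow> 'e" where
  "scoord c X \<equiv> \<lambda>y. tcoord A c (f y) (X y)"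

lemma preimage_open:
  assumes "open U"
  obtains V where "open V" "S \<inter> f -` U = S \<inter> V"
proof -
  have "continuous_on S f" using smooth_f by (simp add: smooth_map_on_def)
  then obtain V where "open V" "V \<inter> S = f -` U \<inter> S"
    using assms unfolding continuous_on_open_invariant by blast
  then show ?thesis using that[of V] by blast
qed

lemma chart_preimage_open:
  assumes "c \<in> A"
  obtains V where "open V" "S \<inter> f -` fst c = S \<inter> V"
  using preimage_open[OF open_chart_domain[OF assms]] by blast

lemma deriv_domain_preimage: "c \<in> A \<Longrightarrow> deriv_domain (S \<inter> f -` fst c)"
  using chart_preimage_open deriv_domain_Int_open[OF domS] by metis

lemma ddir_preimage:
  assumes "c \<in> A" "y \<in> S" "f y \<in> fst c"
  shows "ddir (S \<inter> f -` fst c) u h y = ddir S u h y"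
proof -
  obtain V where "open V" "S \<inter> f -` fst c = S \<inter> V" using chart_preimage_open[OF assms(1)] by blast
  then show ?thesis using assms ddir_Int_open[of V y S] by auto
qed

lemma at_within_preimage:
  assumes "c \<in> A" "y \<in> S" "f y \<in> fst c"
  shows "at y within (S \<inter> f -` fst c) = at y within S"
proof -
  obtain V where "open V" "S \<inter> f -` fst c = S \<inter> V" using chart_preimage_open[OF assms(1)] by blast
  then show ?thesis using assms at_within_Int_open[of V y S] by auto
qed

lemma ddir_cong_preimage:
  assumes "c \<in> A" "y \<in> S" "f y \<in> fst c" "\<And>z. z \<in> S \<Longrightarrow> f z \<in> fst c \<Longrightarrow> h z = k z"
  shows "ddir S u h y = ddir S u k y"
proof -
  obtain V where V: "open V" "S \<inter> f -` fst c = S \<inter> V" using chart_preimage_open[OF assms(1)]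
    by blast
  show ?thesis by (rule ddir_cong_Int_open[OF V(1)]) (use assms V in auto)
qed

lemma smooth_on_fcoord: "c \<in> A \<Longrightarrow> smooth_on (S \<inter> f -` fst c) (fcoord c)"
  using smooth_f by (simp add: smooth_map_on_def)

lemma smooth_on_scoord: "smooth_along X \<Longrightarrow> c \<in> A \<Longrightarrow> smooth_on (S \<inter> f -` fst c) (scoord c X)"
  by (simp add: smooth_along_def)

lemma has_derivative_preimage:
  assumes "c \<in> A" "y \<in> S" "f y \<in> fst c" "smooth_on (S \<inter> f -` fst c) h"
  shows "(h has_derivative (\<lambda>u. ddir S u h y)) (at y within S)"
  using smooth_on_has_derivative[OF assms(4) deriv_domain_preimage[OF assms(1)], of y] assms
  by (simp add: at_within_preimage ddir_preimage)

lemma smooth_on_ddir_preimage: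
  assumes "c \<in> A" "smooth_on (S \<inter> f -` fst c) h"
  shows "smooth_on (S \<inter> f -` fst c) (ddir S u h)"
proof -
  have "smooth_on (S \<inter> f -` fst c) (ddir (S \<inter> f -` fst c) u h)"
    by (rule smooth_on_ddir[OF assms(2) deriv_domain_preimage[OF assms(1)]])
  also have "?this \<longleftrightarrow> ?thesis" by (rule smooth_on_cong) (use assms in \<open>auto simp: ddir_preimage\<close>)
  finally show ?thesis .
qed

lemma pushforward_coord:
  assumes c: "c \<in> A" and y: "y \<in> S" "f y \<in> fst c"
  shows "tcoord A c (f y) (pushforward A S f u y) = ddir S u (fcoord c) y"
proof -
  let ?d = "chart_at A (f y)"
  have "((\<lambda>z. transition ?d c (fcoord ?d z))
      has_derivative (\<lambda>u. tchange ?d c (f y) (ddir S u (fcoord ?d) y))) (at y within S)"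
  proof (rule has_derivative_compose[where g = "transition ?d c" and g' = "tchange ?d c (f y)"])
    show "(fcoord ?d has_derivative (\<lambda>u. ddir S u (fcoord ?d) y)) (at y within S)"
      using y smooth_on_fcoord by (intro has_derivative_preimage[of ?d]) auto
  qed (use c y in \<open>auto intro: transition_has_derivative\<close>)
  from ddir_eq[OF this domS y(1)]
  have "ddir S u (\<lambda>z. transition ?d c (fcoord ?d z)) y = tcoord A c (f y) (pushforward A S f u y)"
    by (simp add: tcoord_eq_tchange pushforward_def ddir_def)
  also have "ddir S u (\<lambda>z. transition ?d c (fcoord ?d z)) y = ddir S u (fcoord c) y"
    by (rule ddir_cong_preimage[of ?d]) (use c y in auto)
  finally show ?thesis by simp
qed

lemma smooth_along_pushforward: "smooth_along (pushforward A S f u)"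
  unfolding smooth_along_def
proof
  fix c assume c: "c \<in> A"
  have "smooth_on (S \<inter> f -` fst c) (ddir S u (fcoord c))"
    by (intro smooth_on_ddir_preimage smooth_on_fcoord c)
  also have "?this \<longleftrightarrow> smooth_on (S \<inter> f -` fst c) (scoord c (pushforward A S f u))"
    by (rule smooth_on_cong) (use c in \<open>auto simp: pushforward_coord\<close>)
  finally show "smooth_on (S \<inter> f -` fst c) (scoord c (pushforward A S f u))" .
qed

end

locale param_conn = affine_conn A D + param_map A S f
  for A :: "('m::{t2_space, second_countable_topology}, 'e::euclidean_space) chart set"
    and D and S :: "'p::euclidean_space set" and f
begin

abbreviation nab :: "'p \<Rightarrow> ('p \<Rightarrow> 'e) \<Rightarrow> 'p \<Rightarrow> 'e" where
  "nab u X \<equiv> induced_deriv A D f S u X"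

abbreviation push :: "'p \<Rightarrow> 'p \<Rightarrow> 'e" where
  "push u \<equiv> pushforward A S f u"

text \<open>
  The induced derivative is defined through the chart \<open>chart_at\<close> at each point, which jumps from
  point to point. In a fixed chart \<open>c\<close> it has the expected expression: expand \<open>X\<close> in the
  coordinate fields of \<open>chart_at\<close>, whose components in \<open>c\<close> contribute their own derivatives.
\<close>

lemma induced_coord:
  assumes c: "c \<in> A" and y: "y \<in> S" "f y \<in> fst c" and X: "smooth_along X"
  shows "tcoord A c (f y) (nab u X y) = ddir S u (scoord c X) y
    + bil (chris c) (ddir S u (fcoord c) y) (scoord c X y) (fcoord c y)"
proof -
  let ?d = "chart_at A (f y)" and ?p = "f y"
  let ?e = "\<lambda>b q. tvec A ?d q b"
  let ?E = "\<lambda>b. field_coord A c (?e b)"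
  have lin: "linear (tcoord A c ?p)" by (rule linear_tcoord[OF c y(2)])
  have ef: "vector_field_near A ?p (?e b)" for b by (intro frame_field) auto
  have dE: "(?E b has_derivative (\<lambda>v. ddir UNIV v (?E b) (snd c ?p))) (at (snd c ?p))" for b
    by (rule field_coord_has_derivative[OF ef c y(2)])
  have dX: "(scoord ?d X has_derivative (\<lambda>u. ddir S u (scoord ?d X) y)) (at y within S)"
    using y X by (intro has_derivative_preimage[of ?d] smooth_on_scoord) auto
  have dx: "(fcoord c has_derivative (\<lambda>u. ddir S u (fcoord c) y)) (at y within S)"
    using y c by (intro has_derivative_preimage[of c] smooth_on_fcoord) auto
  have dEx: "((\<lambda>z. ?E b (fcoord c z))
      has_derivative (\<lambda>u. ddir UNIV (ddir S u (fcoord c) y) (?E b) (snd c ?p)))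
          (at y within S)" for b
    by (rule has_derivative_compose[OF dx dE])
  \<comment> \<open>Along \<open>f\<close>, the components of \<open>X\<close> in \<open>c\<close> are \<open>\<Sum>\<^sub>b X\<^sup>b E\<^sub>b\<close>, where \<open>X\<^sup>b\<close> are the components
      in \<open>?d\<close>; apply the product rule.\<close>
  have "((\<lambda>z. \<Sum>b\<in>Basis. (scoord ?d X z \<bullet> b) *\<^sub>R ?E b (fcoord c z)) has_derivative
      (\<lambda>u. \<Sum>b\<in>Basis. (scoord ?d X y \<bullet> b) *\<^sub>R ddir UNIV (ddir S u (fcoord c) y) (?E b) (snd c ?p)
         + (ddir S u (scoord ?d X) y \<bullet> b) *\<^sub>R ?E b (fcoord c y))) (at y within S)"
    by (intro has_derivative_sum has_derivative_scaleR has_derivative_inner_left dX dEx)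
  from ddir_eq[OF this domS y(1), of u]
  have "ddir S u (\<lambda>z. \<Sum>b\<in>Basis. (scoord ?d X z \<bullet> b) *\<^sub>R ?E b (fcoord c z)) y =
      (\<Sum>b\<in>Basis. (X y \<bullet> b) *\<^sub>R ddir UNIV (ddir S u (fcoord c) y) (?E b) (snd c ?p))
      + (\<Sum>b\<in>Basis. (ddir S u (scoord ?d X) y \<bullet> b) *\<^sub>R tcoord A c ?p b)"
    using c y by (simp add: sum.distrib)
  also have "(\<Sum>b\<in>Basis. (ddir S u (scoord ?d X) y \<bullet> b) *\<^sub>R tcoord A c ?p b)
      = tcoord A c ?p (ddir S u (scoord ?d X) y)"
    by (subst (2) euclidean_representation[symmetric])
      (simp add: linear_sum[OF lin] linear_cmul[OF lin])
  also have "ddir S u (\<lambda>z. \<Sum>b\<in>Basis. (scoord ?d X z \<bullet> b) *\<^sub>R ?E b (fcoord c z)) y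
      = ddir S u (scoord c X) y"
  proof -
    obtain U where U: "open U" "S \<inter> f -` (fst c \<inter> fst ?d) = S \<inter> U"
      using preimage_open[OF open_Int[OF open_chart_domain[OF c] open_chart_domain[OF chart_at_in]]]
      by blast
    show ?thesis
    proof (rule ddir_cong_Int_open[OF U(1)])
      fix z assume "z \<in> S \<inter> U"
      then have z: "z \<in> S" "f z \<in> fst c" "f z \<in> fst ?d" using U by auto
      have "scoord c X z = tcoord A c (f z) (\<Sum>b\<in>Basis. (scoord ?d X z \<bullet> b) *\<^sub>R ?e b (f z))"
        using vector_expand_frame[OF chart_at_in z(3), of "X z"] by simp
      also have "\<dots> = (\<Sum>b\<in>Basis. (scoord ?d X z \<bullet> b) *\<^sub>R ?E b (fcoord c z))"
        using linear_tcoord[OF c z(2)] c z by (simp add: linear_sum linear_cmul)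
      finally show "(\<Sum>b\<in>Basis. (scoord ?d X z \<bullet> b) *\<^sub>R ?E b (fcoord c z)) = scoord c X z" by simp
    qed (use U y in auto)
  qed
  finally have eq: "ddir S u (scoord c X) y =
     (\<Sum>b\<in>Basis. (X y \<bullet> b) *\<^sub>R ddir UNIV (ddir S u (fcoord c) y) (?E b) (snd c ?p))
     + tcoord A c ?p (ddir S u (scoord ?d X) y)" .
  have "tcoord A c ?p (nab u X y) = tcoord A c ?p (ddir S u (scoord ?d X) y)
     + (\<Sum>b\<in>Basis. (X y \<bullet> b) *\<^sub>R tcoord A c ?p (D ?p (push u y) (?e b)))"
    unfolding induced_deriv_def Let_def ddir_def
    by (simp add: linear_add[OF lin] linear_sum[OF lin] linear_cmul[OF lin])
  also have "(\<Sum>b\<in>Basis. (X y \<bullet> b) *\<^sub>R tcoord A c ?p (D ?p (push u y) (?e b))) =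
     (\<Sum>b\<in>Basis. (X y \<bullet> b) *\<^sub>R ddir UNIV (ddir S u (fcoord c) y) (?E b) (snd c ?p))
     + (\<Sum>b\<in>Basis. (X y \<bullet> b) *\<^sub>R bil (chris c) (ddir S u (fcoord c) y) (tcoord A c ?p b) (snd c ?p))"
    using c y by (simp add: connection_coord[OF c y(2) ef] pushforward_coord[OF c y]
      scaleR_add_right sum.distrib)
  also have "(\<Sum>b\<in>Basis. (X y \<bullet> b) *\<^sub>R bil (chris c) (ddir S u (fcoord c) y) (tcoord A c ?p b)
      (snd c ?p))
     = bil (chris c) (ddir S u (fcoord c) y) (scoord c X y) (snd c ?p)" (is "?l = ?r")
  proof -
    have lb: "linear (\<lambda>w. bil (chris c) (ddir S u (fcoord c) y) (tcoord A c ?p w) (snd c ?p))"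
      by (rule linearI) (simp_all add: linear_add[OF lin] linear_cmul[OF lin] bil_add_right
        bil_scaleR_right)
    have "?r = bil (chris c) (ddir S u (fcoord c) y) (tcoord A c ?p (\<Sum>b\<in>Basis. (X y \<bullet> b) *\<^sub>R b))
        (snd c ?p)"
      by (simp add: euclidean_representation)
    also have "\<dots> = ?l" by (simp add: linear_sum[OF lb] linear_cmul[OF lb])
    finally show ?thesis by simp
  qed
  finally show ?thesis using eq by simp
qed

lemma smooth_along_induced:
  assumes X: "smooth_along X" shows "smooth_along (nab u X)"
  unfolding smooth_along_def
proof
  fix c assume c: "c \<in> A"
  have x: "smooth_on (S \<inter> f -` fst c) (fcoord c)" by (rule smooth_on_fcoord[OF c])
  have ch: "smooth_on (S \<inter> f -` fst c) (\<lambda>y. chris c i j (fcoord c y))" for i j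
    by (rule smooth_on_compose[OF smooth_on_chris[OF c] x]) auto
  have "smooth_on (S \<inter> f -` fst c) (\<lambda>y. ddir S u (scoord c X) y
    + bil (\<lambda>i j y. chris c i j (fcoord c y)) (ddir S u (fcoord c) y) (scoord c X y) y)"
    by (intro smooth_on_add smooth_on_bil smooth_on_ddir_preimage smooth_on_scoord X x c ch)
  also have "?this \<longleftrightarrow> smooth_on (S \<inter> f -` fst c) (scoord c (nab u X))"
    by (rule smooth_on_cong) (use c X in \<open>auto simp: induced_coord bil_def\<close>)
  finally show "smooth_on (S \<inter> f -` fst c) (scoord c (nab u X))" .
qed

end


section \<open>Torsion and curvature in coordinates\<close>

lemma ddir_expand:
  assumes "smooth_on S F" "deriv_domain S" "x \<in> S"
  shows "ddir S h F x = (\<Sum>a\<in>Basis. (h \<bullet> a) *\<^sub>R ddir S a F x)"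
proof -
  have l: "linear (\<lambda>u. ddir S u F x)"
    using smooth_on_has_derivative[OF assms] by (rule has_derivative_linear)
  have "ddir S h F x = ddir S (\<Sum>a\<in>Basis. (h \<bullet> a) *\<^sub>R a) F x"
    by (simp only: euclidean_representation)
  also have "\<dots> = (\<Sum>a\<in>Basis. (h \<bullet> a) *\<^sub>R ddir S a F x)"
    by (simp only: linear_sum[OF l] linear_cmul[OF l])
  finally show ?thesis .
qed

lemma bil_commute:
  assumes "\<And>i j. i \<in> Basis \<Longrightarrow> j \<in> Basis \<Longrightarrow> C i j x = C j i x"
  shows "bil C u w x = bil C w u x"
  unfolding bil_def by (subst sum.swap) (intro sum.cong refl, simp add: assms mult.commute)

text \<open>
  The derivative of \<open>\<xi> \<mapsto> DZ(\<xi>)(Y \<xi>)\<close>, the differential part of \<open>\<nabla>\<^sub>Y Z\<close>, where point and direction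
  both vary. The first summand on the right is the second derivative \<open>D\<^sup>2Z(h, Y)\<close>, whose symmetry
  matters for the curvature.
\<close>

lemma ddir_covariant_derivative:
  fixes Y :: "'e::euclidean_space \<Rightarrow> 'e" and Z :: "'e \<Rightarrow> 'b::euclidean_space"
  assumes V: "open V" and x: "x \<in> V"
    and Y: "smooth_on V Y" and Z: "smooth_on V Z"
  shows "ddir V h (\<lambda>\<xi>. ddir V (Y \<xi>) Z \<xi>) x
    = bil (\<lambda>a b. ddir V a (ddir V b Z)) h (Y x) x + ddir V (ddir V h Y x) Z x"
proof -
  note dom = deriv_domain_open[OF V]
  have "((\<lambda>\<xi>. \<Sum>b\<in>Basis. (Y \<xi> \<bullet> b) *\<^sub>R ddir V b Z \<xi>) has_derivative
     (\<lambda>h. \<Sum>b\<in>Basis. (Y x \<bullet> b) *\<^sub>R ddir V h (ddir V b Z) x + (ddir V h Y x \<bullet> b) *\<^sub>R ddir V b Z x))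
         (at x within V)"
    by (rule has_derivative_sum has_derivative_scaleR has_derivative_inner_left
        smooth_on_has_derivative[OF Y dom x]
            smooth_on_has_derivative[OF smooth_on_ddir[OF Z dom] dom x])+
  from ddir_eq[OF this dom x, of h]
  have "ddir V h (\<lambda>\<xi>. \<Sum>b\<in>Basis. (Y \<xi> \<bullet> b) *\<^sub>R ddir V b Z \<xi>) x =
     (\<Sum>b\<in>Basis. (Y x \<bullet> b) *\<^sub>R ddir V h (ddir V b Z) x)
         + (\<Sum>b\<in>Basis. (ddir V h Y x \<bullet> b) *\<^sub>R ddir V b Z x)"
    by (simp add: sum.distrib)
  also have "(\<Sum>b\<in>Basis. (ddir V h Y x \<bullet> b) *\<^sub>R ddir V b Z x) = ddir V (ddir V h Y x) Z x"
    by (rule ddir_expand[OF Z dom x, symmetric])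
  also have "(\<Sum>b\<in>Basis. (Y x \<bullet> b) *\<^sub>R ddir V h (ddir V b Z) x)
      = bil (\<lambda>a b. ddir V a (ddir V b Z)) h (Y x) x"
    unfolding bil_def ddir_expand[OF smooth_on_ddir[OF Z dom] dom x, of h]
    by (subst sum.swap) (simp add: scaleR_sum_right mult.commute)
  also have "ddir V h (\<lambda>\<xi>. \<Sum>b\<in>Basis. (Y \<xi> \<bullet> b) *\<^sub>R ddir V b Z \<xi>) x
      = ddir V h (\<lambda>\<xi>. ddir V (Y \<xi>) Z \<xi>) x"
    by (rule ddir_cong[OF _ x]) (rule ddir_expand[OF Z dom, symmetric])
  finally show ?thesis .
qed

context affine_conn
begin

text \<open>
  The derivative terms of \<open>D\<^sub>X Y\<close> and \<open>D\<^sub>Y X\<close> cancel against the Lie bracket. So the torsion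
  depends only on the values \<open>X p\<close> and \<open>Y p\<close>, whatever fields extend them.
\<close>

lemma torsion_coord:
  assumes X: "vector_field_near A p X" and Y: "vector_field_near A p Y"
  defines "c \<equiv> chart_at A p"
  shows "torsion A D X Y p = bil (chris c) (X p) (Y p) (snd c p)
      - bil (chris c) (Y p) (X p) (snd c p)"
proof -
  have c: "c \<in> A" "p \<in> fst c" by (auto simp: c_def)
  have [simp]: "tcoord A c p v = v" for v by (simp add: c_def)
  have "D p v Z = ddir UNIV v (field_coord A c Z) (snd c p) + bil (chris c) v (Z p) (snd c p)"
    if "vector_field_near A p Z" for Z v
    using connection_coord[OF c that, of v] by simp
  then show ?thesis
    using X Y by (simp add: torsion_def lie_bracket_def Let_def c_def[symmetric] ddir_def)
qed

text \<open>
  The coordinate expression of the curvature, \<open>R(u,v)w = (\<partial>\<^sub>u \<Gamma>)(v,w) - (\<partial>\<^sub>v \<Gamma>)(u,w) + \<Gamma>(u,\<Gamma>(v,w))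
  - \<Gamma>(v,\<Gamma>(u,w))\<close>. It involves only the values of the fields at the point.
\<close>

definition curv :: "('m, 'e) chart \<Rightarrow> 'e \<Rightarrow> 'e \<Rightarrow> 'e \<Rightarrow> 'e \<Rightarrow> 'e" where
  "curv c x u v w =
     bil (\<lambda>i j h. ddir UNIV h (chris c i j) x) v w u
         - bil (\<lambda>i j h. ddir UNIV h (chris c i j) x) u w v
     + bil (chris c) u (bil (chris c) v w x) x - bil (chris c) v (bil (chris c) u w x) x"

lemma chris_has_derivative:
  assumes c: "c \<in> A" "x \<in> snd c ` fst c"
  shows "(chris c i j has_derivative (\<lambda>h. ddir UNIV h (chris c i j) x)) (at x)"
proof -
  note V = open_chart_range[OF c(1)]
  from smooth_on_has_derivative[OF smooth_on_chris[OF c(1)] deriv_domain_open[OF V] c(2)]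
  show ?thesis
    by (simp add: at_within_open[OF c(2) V] ddir_Int_open[OF V c(2), of UNIV, simplified])
qed

text \<open>
  An iterated covariant derivative differentiates the components of \<open>D\<^sub>Y Z\<close>, so the coordinate
  formulas have to hold on a whole neighbourhood of \<open>p\<close>, common to the fields involved.
\<close>

lemma common_field_domain:
  assumes "vector_field_near A p X" "vector_field_near A p Y" "vector_field_near A p Z" "c \<in> A"
      "p \<in> fst c"
  obtains V where "open V" "snd c p \<in> V" "V \<subseteq> snd c ` fst c"
    "smooth_on V (field_coord A c X)" "smooth_on V (field_coord A c Y)"
        "smooth_on V (field_coord A c Z)"
    "\<And>\<xi>. \<xi> \<in> V \<Longrightarrow> vector_field_near A (chart_inv c \<xi>) Z"
proof -
  note iff = vector_field_near_iff[OF assms(4,5)]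
  obtain V1 where V1: "open V1" "snd c p \<in> V1" "smooth_on V1 (field_coord A c X)"
    using assms(1) unfolding iff by auto
  obtain V2 where V2: "open V2" "snd c p \<in> V2" "smooth_on V2 (field_coord A c Y)"
    using assms(2) unfolding iff by auto
  obtain V3 where V3: "open V3" "snd c p \<in> V3" "V3 \<subseteq> snd c ` fst c"
      "smooth_on V3 (field_coord A c Z)"
    using assms(3) unfolding iff by auto
  let ?V = "V1 \<inter> V2 \<inter> V3"
  show thesis
  proof (rule that[of ?V])
    show "vector_field_near A (chart_inv c \<xi>) Z" if "\<xi> \<in> ?V" for \<xi>
    proof -
      have "\<xi> \<in> snd c ` fst c" using that V3 by blast
      then have q: "chart_inv c \<xi> \<in> fst c" "snd c (chart_inv c \<xi>) = \<xi>" using assms(4) by auto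
      show ?thesis
        unfolding vector_field_near_iff[OF assms(4) q(1)] q(2) using V3 that by blast
    qed
  qed (use V1 V2 V3 in \<open>auto intro: smooth_on_subset[OF V1(3)] smooth_on_subset[OF V2(3)]
      smooth_on_subset[OF V3(4)]\<close>)
qed

text \<open>
  Second derivatives of \<open>Z\<close> cancel by symmetry, first derivatives of \<open>X\<close> and \<open>Y\<close> cancel against
  the Lie bracket.
\<close>

lemma curvature_coord:
  assumes X: "vector_field_near A p X" and Y: "vector_field_near A p Y"
      and Z: "vector_field_near A p Z"
  defines "c \<equiv> chart_at A p"
  shows "curvature A D X Y Z p = curv c (snd c p) (X p) (Y p) (Z p)"
proof -
  have c: "c \<in> A" "p \<in> fst c" by (auto simp: c_def)
  have id [simp]: "tcoord A c p v = v" for v by (simp add: c_def)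
  let ?x = "snd c p" and ?X = "field_coord A c X" and ?Y = "field_coord A c Y"
      and ?Z = "field_coord A c Z"
  let ?dC = "\<lambda>i j h. ddir UNIV h (chris c i j) ?x"
  obtain V where V: "open V" "?x \<in> V" "V \<subseteq> snd c ` fst c"
    "smooth_on V ?X" "smooth_on V ?Y" "smooth_on V ?Z"
    and VZ: "\<And>\<xi>. \<xi> \<in> V \<Longrightarrow> vector_field_near A (chart_inv c \<xi>) Z"
    using common_field_domain[OF X Y Z c] by blast
  note dom = deriv_domain_open[OF V(1)]
  have UV: "ddir UNIV h F \<xi> = ddir V h F \<xi>" if "\<xi> \<in> V" for h \<xi> and F :: "'e \<Rightarrow> 'e"
    using ddir_Int_open[OF V(1) that, of UNIV h F] by simp
  have first: "D p v W = ddir V v (field_coord A c W) ?x + bil (chris c) v (W p) ?x"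
    if "vector_field_near A p W" for W v
    using connection_coord[OF c that, of v] UV[OF V(2)] by simp
  \<comment> \<open>The components of \<open>\<nabla>\<^sub>h \<nabla>\<^sub>W Z\<close>, used for \<open>W = X\<close> and for \<open>W = Y\<close>.\<close>
  have second: "D p h (\<lambda>q. D q (W q) Z) =
      bil (\<lambda>a b. ddir V a (ddir V b ?Z)) h (W p) ?x + ddir V (ddir V h (field_coord A c W) ?x) ?Z ?x
      + (bil ?dC (W p) (Z p) h + bil (chris c) (ddir V h (field_coord A c W) ?x) (Z p) ?x
         + bil (chris c) (W p) (ddir V h ?Z ?x) ?x)
      + bil (chris c) h (ddir V (W p) ?Z ?x + bil (chris c) (W p) (Z p) ?x) ?x"
    if W: "vector_field_near A p W" and WV: "smooth_on V (field_coord A c W)" for W h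
  proof -
    let ?W = "field_coord A c W"
    let ?N = "\<lambda>\<xi>. ddir V (?W \<xi>) ?Z \<xi> + bil (chris c) (?W \<xi>) (?Z \<xi>) \<xi>"
    have eqN: "field_coord A c (\<lambda>q. D q (W q) Z) \<xi> = ?N \<xi>" if "\<xi> \<in> V" for \<xi>
    proof -
      have "\<xi> \<in> snd c ` fst c" using that V by blast
      then obtain q where q: "\<xi> = snd c q" "q \<in> fst c" by blast
      have "vector_field_near A q Z" using VZ[OF that] q c by simp
      from connection_coord[OF c(1) q(2) this] show ?thesis
        using q c UV[OF that] by simp
    qed
    have smZ: "smooth_on V (\<lambda>\<xi>. ddir V (?W \<xi>) ?Z \<xi>)"
    proof -
      have "smooth_on V (\<lambda>\<xi>. \<Sum>a\<in>Basis. (?W \<xi> \<bullet> a) *\<^sub>R ddir V a ?Z \<xi>)"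
        by (intro smooth_on_sum smooth_on_scaleR smooth_on_inner_const smooth_on_ddir WV V dom) auto
      also have "?this \<longleftrightarrow> ?thesis"
        by (rule smooth_on_cong) (simp add: ddir_expand[OF V(6) dom, symmetric])
      finally show ?thesis .
    qed
    have d1: "((\<lambda>\<xi>. ddir V (?W \<xi>) ?Z \<xi>) has_derivative (\<lambda>h. ddir V h (\<lambda>\<xi>. ddir V (?W \<xi>) ?Z \<xi>) ?x))
        (at ?x within V)"
      by (rule smooth_on_has_derivative[OF smZ dom V(2)])
    have d2: "((\<lambda>\<xi>. bil (chris c) (?W \<xi>) (?Z \<xi>) \<xi>) has_derivative
       (\<lambda>h. bil ?dC (?W ?x) (?Z ?x) h + bil (chris c) (ddir V h ?W ?x) (?Z ?x) ?x
           + bil (chris c) (?W ?x) (ddir V h ?Z ?x) ?x)) (at ?x within V)"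
      by (intro has_derivative_bil smooth_on_has_derivative WV V dom
        has_derivative_at_withinI[OF chris_has_derivative]) (use c in auto)
    have "ddir V h (field_coord A c (\<lambda>q. D q (W q) Z)) ?x = ddir V h ?N ?x"
      by (rule ddir_cong[OF eqN V(2)])
    also have "\<dots> = ddir V h (\<lambda>\<xi>. ddir V (?W \<xi>) ?Z \<xi>) ?x
        + (bil ?dC (?W ?x) (?Z ?x) h + bil (chris c) (ddir V h ?W ?x) (?Z ?x) ?x
            + bil (chris c) (?W ?x) (ddir V h ?Z ?x) ?x)"
      by (rule ddir_eq[OF has_derivative_add[OF d1 d2] dom V(2)])
    finally show ?thesis
      using ddir_covariant_derivative[OF V(1,2) WV V(6), of h] c first[OF D_field[OF W Z], of h]
        first[OF Z, of "W p"] by simp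
  qed
  have lie: "lie_bracket A X Y p = ddir V (X p) ?Y ?x - ddir V (Y p) ?X ?x"
    using UV[OF V(2)] by (simp add: lie_bracket_def Let_def c_def[symmetric] ddir_def)
  have lin: "linear (\<lambda>u. ddir V u ?Z ?x)"
    using smooth_on_has_derivative[OF V(6) dom V(2)] by (rule has_derivative_linear)
  have sym: "bil (\<lambda>a b. ddir V a (ddir V b ?Z)) (X p) (Y p) ?x
      = bil (\<lambda>a b. ddir V a (ddir V b ?Z)) (Y p) (X p) ?x"
    by (rule bil_commute) (rule ddir_commute[OF V(6) dom V(2)])
  show ?thesis
    unfolding curvature_def curv_def second[OF X V(4)] second[OF Y V(5)] first[OF Z] lie
    by (simp add: sym linear_diff[OF lin] bil_diff_left bil_add_right algebra_simps)
qed

end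

context param_conn
begin

text \<open>
  Let \<open>x\<close> be the coordinate expression of \<open>f\<close>. Then \<open>\<partial>\<^sub>u \<partial>\<^sub>v x = \<partial>\<^sub>v \<partial>\<^sub>u x\<close>, so only the skew part
  of the Christoffel terms is left.
\<close>

lemma nab_torsion:
  assumes y: "y \<in> S"
    and X: "vector_field_near A (f y) X" "X (f y) = push u y"
    and Y: "vector_field_near A (f y) Y" "Y (f y) = push v y"
  shows "nab u (push v) y - nab v (push u) y = torsion A D X Y (f y)"
proof -
  define c where "c = chart_at A (f y)"
  have c: "c \<in> A" "f y \<in> fst c" by (auto simp: c_def)
  have id [simp]: "tcoord A c (f y) v = v" for v by (simp add: c_def)
  have dd: "ddir S u (scoord c (push v)) y = ddir S u (ddir S v (fcoord c)) y" for u v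
    by (rule ddir_cong_preimage[OF c(1) y c(2)]) (simp add: pushforward_coord[OF c(1)])
  have pc: "ddir S u (fcoord c) y = push u y" for u using pushforward_coord[OF c(1) y c(2)] by simp
  have comm: "ddir S u (ddir S v (fcoord c)) y = ddir S v (ddir S u (fcoord c)) y"
  proof -
    let ?N = "S \<inter> f -` fst c"
    have "ddir ?N u (ddir ?N v (fcoord c)) y = ddir ?N v (ddir ?N u (fcoord c)) y"
      by (rule ddir_commute[OF smooth_on_fcoord[OF c(1)] deriv_domain_preimage[OF c(1)]])
        (use y c in auto)
    moreover have "ddir ?N u (ddir ?N v (fcoord c)) y = ddir S u (ddir S v (fcoord c)) y" for u v
      unfolding ddir_preimage[OF c(1) y c(2)]
      by (rule ddir_cong_preimage[OF c(1) y c(2)]) (simp add: ddir_preimage[OF c(1)])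
    ultimately show ?thesis by simp
  qed
  have "nab u (push v) y = ddir S u (ddir S v (fcoord c)) y
      + bil (chris c) (push u y) (push v y) (fcoord c y)" for u v
    using induced_coord[OF c(1) y c(2) smooth_along_pushforward, of u v] dd pc by simp
  then show ?thesis
    using torsion_coord[OF X(1) Y(1)] comm X Y by (simp add: c_def[symmetric])
qed

text \<open>
  The same cancellation as for vector fields, with the second derivatives of the components of \<open>Z\<close>
  and of \<open>f\<close> in the parameters; there is no bracket term because \<open>u\<close> and \<open>v\<close> are constant.
\<close>

lemma nab_curvature:
  assumes y: "y \<in> S" and Z: "smooth_along Z"
    and X: "vector_field_near A (f y) X" "X (f y) = push u y"
    and Y: "vector_field_near A (f y) Y" "Y (f y) = push v y"
    and Z': "vector_field_near A (f y) Z'" "Z' (f y) = Z y"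
  shows "nab u (nab v Z) y - nab v (nab u Z) y = curvature A D X Y Z' (f y)"
proof -
  define c where "c = chart_at A (f y)"
  have c: "c \<in> A" "f y \<in> fst c" by (auto simp: c_def)
  have id [simp]: "tcoord A c (f y) v = v" for v by (simp add: c_def)
  let ?N = "S \<inter> f -` fst c"
  let ?x = "fcoord c" and ?Z = "scoord c Z"
  let ?dC = "\<lambda>i j h. ddir UNIV h (chris c i j) (?x y)"
  have yN: "y \<in> ?N" using y c by auto
  have pc: "ddir S u ?x y = push u y" for u using pushforward_coord[OF c(1) y c(2)] by simp
  have nabc: "tcoord A c (f z) (nab v Z z) = ddir S v ?Z z
      + bil (chris c) (ddir S v ?x z) (?Z z) (?x z)"
    if "z \<in> S" "f z \<in> fst c" for z v by (rule induced_coord[OF c(1) that Z])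
  have sx: "smooth_on ?N ?x" by (rule smooth_on_fcoord[OF c(1)])
  have sZ: "smooth_on ?N ?Z" by (rule smooth_on_scoord[OF Z c(1)])
  note hd = has_derivative_preimage[OF c(1) y c(2)]
  note sd = smooth_on_ddir_preimage[OF c(1)]
  have dC: "((\<lambda>z. chris c i j (?x z)) has_derivative (\<lambda>u. ?dC i j (ddir S u ?x y)))
      (at y within S)" for i j
    by (rule has_derivative_compose[OF hd[OF sx] chris_has_derivative[OF c(1)]]) (use c in auto)
  have nabnab: "nab u (nab v Z) y = ddir S u (ddir S v ?Z) y
      + (bil ?dC (push v y) (Z y) (push u y) + bil (chris c) (ddir S u (ddir S v ?x) y) (Z y) (?x y)
         + bil (chris c) (push v y) (ddir S u ?Z y) (?x y))
      + bil (chris c) (push u y) (ddir S v ?Z y + bil (chris c) (push v y) (Z y) (?x y))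
          (?x y)" for u v
  proof -
    let ?B = "\<lambda>z. bil (\<lambda>i j z. chris c i j (?x z)) (ddir S v ?x z) (?Z z) z"
    have "ddir S u (scoord c (nab v Z)) y = ddir S u (\<lambda>z. ddir S v ?Z z + ?B z) y"
      by (rule ddir_cong_preimage[OF c(1) y c(2)]) (simp add: nabc bil_def)
    also have "\<dots> = ddir S u (ddir S v ?Z) y
       + (bil (\<lambda>i j u. ?dC i j (ddir S u ?x y)) (ddir S v ?x y) (?Z y) u
          + bil (\<lambda>i j z. chris c i j (?x z)) (ddir S u (ddir S v ?x) y) (?Z y) y
          + bil (\<lambda>i j z. chris c i j (?x z)) (ddir S v ?x y) (ddir S u ?Z y) y)"
      by (rule ddir_eq[OF has_derivative_add[OF hd[OF sd[OF sZ]]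
        has_derivative_bil[OF dC hd[OF sd[OF sx]] hd[OF sZ]]] domS y])
    finally have "ddir S u (scoord c (nab v Z)) y = \<dots>" .
    moreover have "nab u (nab v Z) y = ddir S u (scoord c (nab v Z)) y
       + bil (chris c) (push u y) (nab v Z y) (?x y)"
      using induced_coord[OF c(1) y c(2) smooth_along_induced[OF Z], of u v] pc by simp
    moreover have "nab v Z y = ddir S v ?Z y + bil (chris c) (push v y) (Z y) (?x y)"
      using nabc[OF y c(2), of v] pc by simp
    ultimately show ?thesis by (simp add: pc bil_def)
  qed
  have comm: "ddir S u (ddir S v F) y = ddir S v (ddir S u F) y" if F: "smooth_on ?N F"
      for F :: "'p \<Rightarrow> 'e"
  proof -
    have "ddir ?N u (ddir ?N v F) y = ddir ?N v (ddir ?N u F) y"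
      by (rule ddir_commute[OF F deriv_domain_preimage[OF c(1)] yN])
    moreover have "ddir ?N u (ddir ?N v F) y = ddir S u (ddir S v F) y" for u v
      unfolding ddir_preimage[OF c(1) y c(2)]
      by (rule ddir_cong_preimage[OF c(1) y c(2)]) (simp add: ddir_preimage[OF c(1)])
    ultimately show ?thesis by simp
  qed
  show ?thesis
    unfolding curvature_coord[OF X(1) Y(1) Z'(1)] c_def[symmetric] X(2) Y(2) Z'(2) curv_def nabnab
    by (simp add: comm[OF sx] comm[OF sZ] bil_add_right algebra_simps)
qed

end


section \<open>The Strominger-Bismut connection\<close>

locale hermitian = smooth_manifold A
  for A :: "('m::{t2_space, second_countable_topology}, 'e::euclidean_space) chart set" +
  fixes g :: "'m \<Rightarrow> 'e \<Rightarrow> 'e \<Rightarrow> real" and J :: "'m \<Rightarrow> 'e \<Rightarrow> 'e" and LC SB :: "('m, 'e) connection"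
  assumes hermitian: "hermitian_manifold A g J"
    and LC: "levi_civita A g LC" and SB: "strominger_bismut A g J LC SB"
begin

sublocale LC: affine_conn A LC
  by unfold_locales (use LC in \<open>simp add: levi_civita_def\<close>)

sublocale SB: affine_conn A SB
  by unfold_locales (use SB in \<open>simp add: strominger_bismut_def\<close>)

lemma g_bilinear: "bilinear (g p)"
  and g_sym: "g p u v = g p v u"
  and g_pos: "v \<noteq> 0 \<Longrightarrow> 0 < g p v v"
  using hermitian unfolding hermitian_manifold_def riemannian_metric_def by simp_all

lemma g_smooth:
  "vector_field_near A p X \<Longrightarrow> vector_field_near A p Y \<Longrightarrow> smooth_near A p (\<lambda>q. g q (X q) (Y q))"
  using hermitian unfolding hermitian_manifold_def riemannian_metric_def by simp

lemma g_lin1: "linear (\<lambda>u. g p u v)" and g_lin2: "linear (g p u)"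
  using g_bilinear by (auto simp: bilinear_def)

lemmas g_linear = linear_add[OF g_lin1] linear_add[OF g_lin2] linear_diff[OF g_lin1]
  linear_diff[OF g_lin2] linear_cmul[OF g_lin1] linear_cmul[OF g_lin2] linear_sum[OF g_lin1]
  linear_sum[OF g_lin2] linear_0[OF g_lin1] linear_0[OF g_lin2] linear_neg[OF g_lin1]
  linear_neg[OF g_lin2]

lemma g_sum_sum:
  "g p (\<Sum>i\<in>I. a i *\<^sub>R U i) (\<Sum>j\<in>K. b j *\<^sub>R W j) = (\<Sum>i\<in>I. \<Sum>j\<in>K. a i * (b j * g p (U i) (W j)))"
proof -
  have "g p (\<Sum>i\<in>I. a i *\<^sub>R U i) w = (\<Sum>i\<in>I. a i * g p (U i) w)" for w
    by (simp add: linear_sum[OF g_lin1] linear_cmul[OF g_lin1])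
  moreover have "g p v (\<Sum>j\<in>K. b j *\<^sub>R W j) = (\<Sum>j\<in>K. b j * g p v (W j))" for v
    by (simp add: linear_sum[OF g_lin2] linear_cmul[OF g_lin2])
  ultimately show ?thesis
    by (simp only: sum_distrib_left) (subst sum.swap, simp add: mult.left_commute)
qed

lemma g_nondegenerate:
  assumes "\<And>w. g p u w = 0" shows "u = 0"
  using g_pos[of u p] assms[of u] by auto

lemma J_linear: "linear (J p)" and J_square: "J p (J p v) = - v"
  and J_field: "vector_field_near A p X \<Longrightarrow> vector_field_near A p (\<lambda>q. J q (X q))"
  using hermitian
  unfolding hermitian_manifold_def integrable_complex_structure_def almost_complex_structure_def
  by simp_all

lemma g_J_J: "g p (J p u) (J p v) = g p u v"
  using hermitian unfolding hermitian_manifold_def by simp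

abbreviation \<omega> where "\<omega> \<equiv> fundamental_form g J"

lemma \<omega>_skew: "\<omega> p u v = - \<omega> p v u"
  using g_J_J[of p "J p u" v] g_sym[of p u "J p v"]
    by (simp add: fundamental_form_def J_square g_linear)

lemma \<omega>_self [simp]: "\<omega> p u u = 0"
  using \<omega>_skew[of p u u] by simp

lemma \<omega>_zero [simp]: "\<omega> p 0 v = 0"
  by (simp add: fundamental_form_def linear_0[OF J_linear] g_linear)

lemma \<omega>_uminus: "\<omega> p (- u) v = - \<omega> p u v"
  by (simp add: fundamental_form_def linear_neg[OF J_linear] g_linear)

lemma lie_bracket_skew: "lie_bracket A Y X p = - lie_bracket A X Y p"
  by (simp add: lie_bracket_def Let_def)

lemma dir_deriv_uminus:
  assumes "smooth_near A p f"
  shows "dir_deriv A p v (\<lambda>q. - f q) = - dir_deriv A p v f"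
proof -
  let ?F = "\<lambda>x. f (chart_inv (chart_at A p) x)"
  have D: "(?F has_derivative (\<lambda>u. ddir UNIV u ?F (snd (chart_at A p) p)))
      (at (snd (chart_at A p) p))"
    by (rule smooth_near_has_derivative[OF assms chart_at_in in_chart_at])
  show ?thesis
    using dir_deriv_chart[OF chart_at_in in_chart_at D]
      dir_deriv_chart[OF chart_at_in in_chart_at has_derivative_minus[OF D]] by simp
qed

text \<open>
  Because \<open>\<omega>\<close> and the Lie bracket are skew, the six terms of the formula for \<open>d\<omega>\<close> cancel in pairs
  when two fields coincide, and change sign together when two fields are exchanged.
\<close>

lemma ext_deriv2_same: "ext_deriv2 A \<omega> X X Z p = 0"
proof -
  have "lie_bracket A X X p = 0" by (simp add: lie_bracket_def Let_def)
  then show ?thesis by (simp add: ext_deriv2_def dir_deriv_def frechet_derivative_const)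
qed

lemma ext_deriv2_swap:
  assumes "vector_field_near A p Y" "vector_field_near A p Z"
  shows "ext_deriv2 A \<omega> X Z Y p = - ext_deriv2 A \<omega> X Y Z p"
proof -
  have "smooth_near A p (\<lambda>q. \<omega> q (Y q) (Z q))"
    unfolding fundamental_form_def by (rule g_smooth[OF J_field[OF assms(1)] assms(2)])
  from dir_deriv_uminus[OF this]
  have "dir_deriv A p v (\<lambda>q. \<omega> q (Z q) (Y q)) = - dir_deriv A p v (\<lambda>q. \<omega> q (Y q) (Z q))" for v
    by (subst \<omega>_skew) simp
  then show ?thesis
    using lie_bracket_skew[of Z Y p] by (simp add: ext_deriv2_def \<omega>_uminus)
qed

lemma SB_eq:
  assumes "vector_field_near A p X" "vector_field_near A p Y" "vector_field_near A p Z"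
  shows "g p (SB p (X p) Y) (Z p) = g p (LC p (X p) Y) (Z p)
    + 1/2 * ext_deriv2 A \<omega> (\<lambda>q. J q (X q)) (\<lambda>q. J q (Y q)) (\<lambda>q. J q (Z q)) p"
  using SB assms unfolding strominger_bismut_def by blast

text \<open>
  The correction to the Levi-Civita connection is skew in \<open>Y\<close> and \<open>Z\<close>, so it drops out of the sum.
\<close>

lemma SB_metric:
  assumes Y: "vector_field_near A p Y" and Z: "vector_field_near A p Z"
  shows "dir_deriv A p v (\<lambda>q. g q (Y q) (Z q)) = g p (SB p v Y) (Z p) + g p (Y p) (SB p v Z)"
proof -
  have "dir_deriv A p v (\<lambda>q. g q (Y q) (Z q)) = g p (LC p v Y) (Z p) + g p (Y p) (LC p v Z)"
    using LC Y Z unfolding levi_civita_def by blast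
  then show ?thesis
    using SB_eq[OF extend_field Y Z, of v] SB_eq[OF extend_field Z Y, of v]
      ext_deriv2_swap[OF J_field[OF Y] J_field[OF Z], of "\<lambda>q. J q (extend A p v q)"]
    by (simp add: g_sym[of p "Y p"])
qed

text \<open>
  The torsion is \<open>1/2 (d\<omega>(JX,JY,JZ) - d\<omega>(JY,JX,JZ))\<close>, since the Levi-Civita part is torsion free;
  both terms vanish for \<open>Z = Y\<close>.
\<close>

lemma SB_torsion_skew:
  assumes X: "vector_field_near A p X" and Y: "vector_field_near A p Y"
  shows "g p (torsion A SB X Y p) (Y p) = 0"
proof -
  have lc: "LC p (X p) Y - LC p (Y p) X = lie_bracket A X Y p"
    using LC X Y unfolding levi_civita_def by blast
  have "ext_deriv2 A \<omega> (\<lambda>q. J q (X q)) (\<lambda>q. J q (Y q)) (\<lambda>q. J q (Y q)) p = 0"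
    "ext_deriv2 A \<omega> (\<lambda>q. J q (Y q)) (\<lambda>q. J q (X q)) (\<lambda>q. J q (Y q)) p = 0"
    using ext_deriv2_swap[OF J_field[OF Y] J_field[OF Y], of "\<lambda>q. J q (X q)"]
      ext_deriv2_swap[OF J_field[OF Y] J_field[OF X], of "\<lambda>q. J q (Y q)"]
      ext_deriv2_same[of "\<lambda>q. J q (Y q)" "\<lambda>q. J q (X q)"] by simp_all
  then show ?thesis
    using SB_eq[OF X Y Y] SB_eq[OF Y X Y] unfolding torsion_def lc[symmetric]
      by (simp add: g_linear)
qed

lemma SB_self_derivative:
  assumes X: "vector_field_near A p X"
  shows "SB p (X p) X = LC p (X p) X"
proof -
  have "g p (SB p (X p) X - LC p (X p) X) w = 0" for w
    using SB_eq[OF X X extend_field, of w] ext_deriv2_same by (simp add: g_linear)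
  from g_nondegenerate[OF this] show ?thesis by simp
qed

definition gcoef :: "('m, 'e) chart \<Rightarrow> 'e \<Rightarrow> 'e \<Rightarrow> 'e \<Rightarrow> real" where
  "gcoef c i j x = g (chart_inv c x) (tvec A c (chart_inv c x) i) (tvec A c (chart_inv c x) j)"

lemma smooth_on_gcoef:
  assumes c: "c \<in> A" shows "smooth_on (snd c ` fst c) (gcoef c i j)"
proof (rule smooth_on_locally)
  show "deriv_domain (snd c ` fst c)" by (intro deriv_domain_open open_chart_range c)
next
  fix x assume "x \<in> snd c ` fst c"
  then obtain p where p: "p \<in> fst c" "x = snd c p" by blast
  have "smooth_near A p (\<lambda>q. g q (tvec A c q i) (tvec A c q j))"
    by (rule g_smooth[OF frame_field[OF c p(1)] frame_field[OF c p(1)]])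
  then obtain V where V: "open V" "snd c p \<in> V" "smooth_on V (gcoef c i j)"
    unfolding smooth_near_iff[OF c p(1)] gcoef_def[abs_def] by auto
  then show "\<exists>U. open U \<and> x \<in> U \<and> smooth_on (snd c ` fst c \<inter> U) (gcoef c i j)"
    by (intro exI[of _ V]) (auto simp: p intro: smooth_on_subset[OF V(3)])
qed

lemma g_coord:
  assumes c: "c \<in> A" "p \<in> fst c"
  shows "g p u w = bil (gcoef c) (tcoord A c p u) (tcoord A c p w) (snd c p)"
proof -
  have "bilinear (\<lambda>u w. g p (tvec A c p u) (tvec A c p w))"
    unfolding bilinear_def
    using linear_compose[OF linear_tvec[OF c] g_lin1] linear_compose[OF linear_tvec[OF c] g_lin2]
    by (simp add: o_def)
  from bilinear_eq_bil[OF this, of "tcoord A c p u" "tcoord A c p w"]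
  show ?thesis using c by (simp add: bil_def gcoef_def)
qed

end


section \<open>The calculus of fields along a map\<close>

locale hermitian_param = hermitian A g J LC SB + param_map A S f
  for A :: "('m::{t2_space, second_countable_topology}, 'e::euclidean_space) chart set"
    and g J LC SB and S :: "'p::euclidean_space set" and f
begin

sublocale SB: param_conn A SB S f by unfold_locales

lemma smooth_on_metric:
  assumes X: "smooth_along X" and Y: "smooth_along Y"
  shows "smooth_on S (\<lambda>y. g (f y) (X y) (Y y))"
proof (rule smooth_on_locally[OF domS])
  fix y assume y: "y \<in> S"
  let ?c = "chart_at A (f y)"
  let ?N = "S \<inter> f -` fst ?c"
  obtain V where V: "open V" "?N = S \<inter> V" using chart_preimage_open[OF chart_at_in] by blast
  have x: "smooth_on ?N (fcoord ?c)" by (rule smooth_on_fcoord[OF chart_at_in])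
  have "smooth_on ?N (\<lambda>z. bil (\<lambda>i j z. gcoef ?c i j (fcoord ?c z)) (scoord ?c X z) (scoord ?c Y z)
      z)"
  proof (rule smooth_on_bil)
    show "smooth_on ?N (\<lambda>z. gcoef ?c i j (fcoord ?c z))" for i j
      by (rule smooth_on_compose[OF smooth_on_gcoef[OF chart_at_in] x]) auto
  qed (rule smooth_on_scoord[OF X chart_at_in] smooth_on_scoord[OF Y chart_at_in])+
  also have "?this \<longleftrightarrow> smooth_on ?N (\<lambda>y. g (f y) (X y) (Y y))"
    by (rule smooth_on_cong) (auto simp: g_coord[of ?c] bil_def)
  finally show "\<exists>U. open U \<and> y \<in> U \<and> smooth_on (S \<inter> U) (\<lambda>y. g (f y) (X y) (Y y))"
    using V y by (intro exI[of _ V]) auto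
qed

text \<open>
  Metric compatibility passes from vector fields to fields along \<open>f\<close>: the derivative of the metric
  coefficients along \<open>f\<close> is the part that comes from the derivatives of the coordinate fields.
\<close>

lemma metric_compatible:
  assumes y: "y \<in> S" and X: "smooth_along X" and Y: "smooth_along Y"
  shows "ddir S u (\<lambda>z. g (f z) (X z) (Y z)) y = g (f y) (SB.nab u X y) (Y y)
      + g (f y) (X y) (SB.nab u Y y)"
proof -
  define c where "c = chart_at A (f y)"
  let ?p = "f y" and ?x = "snd c (f y)"
  have c: "c \<in> A" "?p \<in> fst c" by (auto simp: c_def)
  have id [simp]: "tcoord A c ?p v = v" "tvec A c ?p v = v" for v by (auto simp: c_def)
  let ?w = "pushforward A S f u y"
  have w: "ddir S u (fcoord c) y = ?w" using pushforward_coord[OF c(1) y c(2)] by simp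
  let ?e = "\<lambda>b q. tvec A c q b"
  have ef: "vector_field_near A ?p (?e b)" for b by (rule frame_field[OF c])
  note hd = has_derivative_preimage[OF c(1) y c(2)]
  have dG: "(gcoef c i j has_derivative (\<lambda>h. ddir UNIV h (gcoef c i j) ?x)) (at ?x)" for i j
    using smooth_near_has_derivative[OF g_smooth[OF ef ef] c, of i j]
      by (simp add: gcoef_def[abs_def])
  have G': "ddir UNIV ?w (gcoef c i j) ?x = g ?p (SB ?p ?w (?e i)) j + g ?p i (SB ?p ?w (?e j))"
      for i j
  proof -
    have "dir_deriv A ?p ?w (\<lambda>q. g q (?e i q) (?e j q)) = ddir UNIV ?w (gcoef c i j) ?x"
      using dir_deriv_chart[OF c, of "\<lambda>q. g q (?e i q) (?e j q)"] dG[of i j]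
      by (simp add: gcoef_def[abs_def])
    then show ?thesis using SB_metric[OF ef ef, of ?w i j] by simp
  qed
  have dGx: "((\<lambda>z. gcoef c i j (fcoord c z))
      has_derivative (\<lambda>u. ddir UNIV (ddir S u (fcoord c) y) (gcoef c i j) ?x))
          (at y within S)" for i j
    by (rule has_derivative_compose[OF hd[OF smooth_on_fcoord[OF c(1)]] dG])
  have "ddir S u (\<lambda>z. g (f z) (X z) (Y z)) y =
      ddir S u (\<lambda>z. bil (\<lambda>i j z. gcoef c i j (fcoord c z)) (scoord c X z) (scoord c Y z) z) y"
    by (rule ddir_cong_preimage[OF c(1) y c(2)]) (simp add: g_coord[OF c(1)] bil_def)
  also have "\<dots> = bil (\<lambda>i j u. ddir UNIV (ddir S u (fcoord c) y) (gcoef c i j) ?x) (scoord c X y)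
      (scoord c Y y) u
      + bil (\<lambda>i j z. gcoef c i j (fcoord c z)) (ddir S u (scoord c X) y) (scoord c Y y) y
      + bil (\<lambda>i j z. gcoef c i j (fcoord c z)) (scoord c X y) (ddir S u (scoord c Y) y) y"
    by (rule ddir_eq[OF has_derivative_bil[OF dGx hd[OF smooth_on_scoord[OF X c(1)]]
      hd[OF smooth_on_scoord[OF Y c(1)]]] domS y])
  also have "\<dots> = bil (\<lambda>i j u. g ?p (SB ?p ?w (?e i)) j + g ?p i (SB ?p ?w (?e j))) (X y) (Y y) u
      + g ?p (ddir S u (scoord c X) y) (Y y) + g ?p (X y) (ddir S u (scoord c Y) y)"
    by (simp add: w G' g_coord[OF c] bil_def)
  also have "bil (\<lambda>i j u. g ?p (SB ?p ?w (?e i)) j + g ?p i (SB ?p ?w (?e j))) (X y) (Y y) u =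
      g ?p (\<Sum>i\<in>Basis. (X y \<bullet> i) *\<^sub>R SB ?p ?w (?e i)) (\<Sum>j\<in>Basis. (Y y \<bullet> j) *\<^sub>R j)
      + g ?p (\<Sum>i\<in>Basis. (X y \<bullet> i) *\<^sub>R i) (\<Sum>j\<in>Basis. (Y y \<bullet> j) *\<^sub>R SB ?p ?w (?e j))"
    by (simp only: g_sum_sum) (simp add: bil_def sum.distrib algebra_simps)
  finally show ?thesis
    unfolding induced_deriv_def Let_def c_def[symmetric] ddir_def[symmetric]
    by (simp add: euclidean_representation linear_add[OF g_lin1] linear_add[OF g_lin2])
qed

end


context hermitian_param
begin

abbreviation push where "push \<equiv> pushforward A S f"
abbreviation nab where "nab \<equiv> SB.nab"
abbreviation tor where "tor y \<equiv> torsion_tensor A g SB (f y)"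
abbreviation cur where "cur y \<equiv> curvature_tensor A g SB (f y)"

text \<open>
  Exchanging the two parameters costs a torsion term; this is where the torsion enters the second
  variation.
\<close>

lemma nab_push_swap:
  assumes "y \<in> S"
  shows "g (f y) (nab u (push v) y) w = g (f y) (nab v (push u) y) w
      + tor y (push u y) (push v y) w"
proof -
  have "nab u (push v) y = nab v (push u) y +
      torsion A SB (extend A (f y) (push u y)) (extend A (f y) (push v y)) (f y)"
    using SB.nab_torsion[OF assms extend_field extend_at extend_field extend_at, of u v]
    by (simp add: algebra_simps)
  then show ?thesis by (simp add: torsion_tensor_def g_linear)
qed

text \<open>
  Consequently the torsion leaves no trace in the first variation.
\<close>

lemma tor_skew: "tor y x w w = 0"
  using SB_torsion_skew[OF extend_field extend_field, of "f y" x w]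
    by (simp add: torsion_tensor_def)

text \<open>
  Second derivatives of the function \<open>\<langle>X, Y\<rangle>\<close> commute, so the commutator of two covariant
  derivatives is skew-adjoint: this is \<open>R(x, y, z, w) = - R(x, y, w, z)\<close>.
\<close>

lemma nab_commutator_skew:
  assumes y: "y \<in> S" and X: "smooth_along X" and Y: "smooth_along Y"
  shows "g (f y) (nab u (nab v X) y - nab v (nab u X) y) (Y y)
    = - g (f y) (X y) (nab u (nab v Y) y - nab v (nab u Y) y)"
proof -
  let ?h = "\<lambda>z. g (f z) (X z) (Y z)"
  note sX = SB.smooth_along_induced[OF X] and sY = SB.smooth_along_induced[OF Y]
  have dd: "ddir S u (ddir S v ?h) y =
      g (f y) (nab u (nab v X) y) (Y y) + g (f y) (nab v X y) (nab u Y y)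
      + (g (f y) (nab u X y) (nab v Y y) + g (f y) (X y) (nab u (nab v Y) y))" for u v
  proof -
    let ?a = "\<lambda>z. g (f z) (nab v X z) (Y z)" and ?b = "\<lambda>z. g (f z) (X z) (nab v Y z)"
    have "ddir S u (ddir S v ?h) y = ddir S u (\<lambda>z. ?a z + ?b z) y"
      by (rule ddir_cong[OF metric_compatible[OF _ X Y] y])
    also have "\<dots> = ddir S u ?a y + ddir S u ?b y"
      by (rule ddir_eq[OF has_derivative_add[OF
        smooth_on_has_derivative[OF smooth_on_metric[OF sX Y] domS y]
              smooth_on_has_derivative[OF smooth_on_metric[OF X sY] domS y]] domS y])
    finally show ?thesis by (simp add: metric_compatible[OF y sX Y] metric_compatible[OF y X sY])
  qed
  have "ddir S u (ddir S v ?h) y = ddir S v (ddir S u ?h) y"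
    by (rule ddir_commute[OF smooth_on_metric[OF X Y] domS y])
  then show ?thesis unfolding dd by (simp add: g_linear)
qed

text \<open>
  \<open>1/2 \<partial>\<^sub>v |f\<^sub>\<tau>|\<^sup>2 = \<langle>\<nabla>\<^sub>v f\<^sub>\<tau>, f\<^sub>\<tau>\<rangle> = \<langle>\<nabla>\<^sub>\<tau> f\<^sub>v, f\<^sub>\<tau>\<rangle> + T(f\<^sub>v, f\<^sub>\<tau>, f\<^sub>\<tau>)\<close>, and the torsion term is
  zero.
\<close>

lemma first_variation_integrand:
  assumes y: "y \<in> S"
  shows "ddir S v (\<lambda>z. g (f z) (push \<tau> z) (push \<tau> z)) y = 2 * g (f y) (nab \<tau> (push v) y) (push \<tau> y)"
  using metric_compatible[OF y smooth_along_pushforward smooth_along_pushforward, of v \<tau> \<tau>]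
    nab_push_swap[OF y, of v \<tau> "push \<tau> y"] tor_skew
  by (simp add: g_sym[of "f y" "push \<tau> y"])

text \<open>
  Differentiate \<open>\<langle>\<nabla>\<^sub>\<tau> f\<^sub>v, f\<^sub>\<tau>\<rangle>\<close> by the product rule. In \<open>\<langle>\<nabla>\<^sub>u \<nabla>\<^sub>\<tau> f\<^sub>v, f\<^sub>\<tau>\<rangle>\<close> exchange the
  derivatives, which gives \<open>\<langle>\<nabla>\<^sub>\<tau> \<nabla>\<^sub>u f\<^sub>v, f\<^sub>\<tau>\<rangle>\<close> and a curvature term; the former is a total
  \<open>\<tau>\<close>-derivative as \<open>\<nabla>\<^sub>\<tau> f\<^sub>\<tau> = 0\<close>. In \<open>\<langle>\<nabla>\<^sub>\<tau> f\<^sub>v, \<nabla>\<^sub>u f\<^sub>\<tau>\<rangle>\<close> exchange \<open>u\<close> and \<open>\<tau>\<close>, which gives the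
  torsion term.
\<close>

lemma second_variation_integrand:
  assumes y: "y \<in> S" and geo: "nab \<tau> (push \<tau>) y = 0"
  shows "ddir S u (\<lambda>z. g (f z) (nab \<tau> (push v) z) (push \<tau> z)) y =
     g (f y) (nab \<tau> (push u) y) (nab \<tau> (push v) y)
     + tor y (push u y) (push \<tau> y) (nab \<tau> (push v) y)
     - cur y (push u y) (push \<tau> y) (push \<tau> y) (push v y)
     + ddir S \<tau> (\<lambda>z. g (f z) (nab u (push v) z) (push \<tau> z)) y"
proof -
  note sp = smooth_along_pushforward
  note sn = SB.smooth_along_induced[OF sp]
  have "ddir S u (\<lambda>z. g (f z) (nab \<tau> (push v) z) (push \<tau> z)) y =
     g (f y) (nab u (nab \<tau> (push v)) y) (push \<tau> y) + g (f y) (nab u (push \<tau>) y) (nab \<tau> (push v) y)"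
    using metric_compatible[OF y sn sp, of u \<tau> v \<tau>]
      by (simp add: g_sym[of "f y" "nab u (push \<tau>) y"])
  moreover have "ddir S \<tau> (\<lambda>z. g (f z) (nab u (push v) z) (push \<tau> z)) y
      = g (f y) (nab \<tau> (nab u (push v)) y) (push \<tau> y)"
    using metric_compatible[OF y sn sp, of \<tau> u v \<tau>] geo by (simp add: g_linear)
  moreover have "g (f y) (nab u (nab \<tau> (push v)) y - nab \<tau> (nab u (push v)) y) (push \<tau> y)
      = - cur y (push u y) (push \<tau> y) (push \<tau> y) (push v y)"
    using nab_commutator_skew[OF y sp sp, of u \<tau> v \<tau>]
      SB.nab_curvature[OF y sp extend_field extend_at extend_field extend_at extend_field
          extend_at, of u \<tau> \<tau>]
    by (simp add: curvature_tensor_def g_sym[of "f y" "push v y"])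
  ultimately show ?thesis
    using nab_push_swap[OF y, of u \<tau> "nab \<tau> (push v) y"] by (simp add: g_linear)
qed

end


section \<open>Restriction to curves\<close>

text \<open>
  A curve in a variation, or a transversal curve, is \<open>f \<circ> \<iota>\<close> for an embedding \<open>\<iota>\<close> of an interval
  into the parameter domain. Derivatives along it are derivatives of the whole map in the
  direction of \<open>\<iota>\<close>.
\<close>

lemma ddir_reparam:
  assumes dom: "deriv_domain T" and im: "\<iota> ` T \<subseteq> S" and x: "x \<in> T"
    and L: "(\<iota> has_derivative L) (at x within T)"
    and F: "(F has_derivative F') (at (\<iota> x) within S)"
  shows "ddir T u (\<lambda>z. F (\<iota> z)) x = F' (L u)"
  by (rule ddir_eq[OF has_derivative_in_compose[OF L has_derivative_subset[OF F im]] dom x])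

context param_map
begin

text \<open>
  The curve \<open>h\<close> has to agree with \<open>f \<circ> \<iota>\<close> on \<open>T\<close> only, since the derivatives are taken within \<open>T\<close>.
\<close>

lemma pushforward_reparam:
  assumes dom: "deriv_domain T" and im: "\<iota> ` T \<subseteq> S" and x: "x \<in> T"
    and L: "(\<iota> has_derivative L) (at x within T)" and h: "\<And>z. z \<in> T \<Longrightarrow> h z = f (\<iota> z)"
  shows "pushforward A T h u x = pushforward A S f (L u) (\<iota> x)"
proof -
  let ?c = "chart_at A (f (\<iota> x))"
  have ix: "\<iota> x \<in> S" using im x by blast
  have "pushforward A T h u x = ddir T u (\<lambda>z. snd ?c (h z)) x"
    by (simp add: pushforward_def ddir_def h[OF x])
  also have "\<dots> = ddir T u (\<lambda>z. fcoord ?c (\<iota> z)) x"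
    by (rule ddir_cong[OF _ x]) (simp add: h)
  also have "\<dots> = ddir S (L u) (fcoord ?c) (\<iota> x)"
    by (rule ddir_reparam[OF dom im x L
      has_derivative_preimage[OF chart_at_in ix _ smooth_on_fcoord]]) auto
  finally show ?thesis by (simp add: pushforward_def ddir_def)
qed

end

context param_conn
begin

lemma induced_reparam:
  assumes dom: "deriv_domain T" and im: "\<iota> ` T \<subseteq> S" and x: "x \<in> T"
    and L: "(\<iota> has_derivative L) (at x within T)" and h: "\<And>z. z \<in> T \<Longrightarrow> h z = f (\<iota> z)"
    and X: "smooth_along X" and X': "\<And>z. z \<in> T \<Longrightarrow> X' z = X (\<iota> z)"
  shows "induced_deriv A D h T u X' x = nab (L u) X (\<iota> x)"
proof -
  let ?c = "chart_at A (f (\<iota> x))"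
  have ix: "\<iota> x \<in> S" using im x by blast
  have "ddir T u (\<lambda>z. tcoord A ?c (h z) (X' z)) x = ddir T u (\<lambda>z. scoord ?c X (\<iota> z)) x"
    by (rule ddir_cong[OF _ x]) (simp add: h X')
  also have "\<dots> = ddir S (L u) (scoord ?c X) (\<iota> x)"
    by (rule ddir_reparam[OF dom im x L
      has_derivative_preimage[OF chart_at_in ix _ smooth_on_scoord[OF X]]]) auto
  finally have "ddir T u (\<lambda>z. tcoord A ?c (h z) (X' z)) x = \<dots>" .
  moreover have "pushforward A T h u x = push (L u) (\<iota> x)"
    by (rule pushforward_reparam[OF dom im x L h])
  ultimately show ?thesis
    unfolding induced_deriv_def Let_def ddir_def[symmetric] h[OF x] X'[OF x] by simp
qed

end

text \<open>
  The two connections differ by a 3-form, which vanishes on the repeated argument; hence they have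
  the same geodesics.
\<close>

lemma (in hermitian_param) SB_LC_acceleration:
  assumes "y \<in> S"
  shows "nab u (push u) y = induced_deriv A LC f S u (push u) y"
proof -
  define c where "c = chart_at A (f y)"
  have c: "c \<in> A" "f y \<in> fst c" by (auto simp: c_def)
  have id [simp]: "tcoord A c (f y) v = v" for v by (simp add: c_def)
  let ?w = "push u y" and ?p = "f y"
  let ?Y = "extend A ?p ?w"
  let ?e = "\<lambda>b q. tvec A c q b"
  have "SB ?p ?w ?Y = ddir UNIV ?w (field_coord A c ?Y) (snd c ?p)
      + (\<Sum>b\<in>Basis. (?w \<bullet> b) *\<^sub>R SB ?p ?w (?e b))"
    using SB.connection_coord[OF c extend_field, of ?w ?w] SB.bil_chris[OF c, of ?w ?w] by simp
  moreover have "LC ?p ?w ?Y = ddir UNIV ?w (field_coord A c ?Y) (snd c ?p)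
      + (\<Sum>b\<in>Basis. (?w \<bullet> b) *\<^sub>R LC ?p ?w (?e b))"
    using LC.connection_coord[OF c extend_field, of ?w ?w] LC.bil_chris[OF c, of ?w ?w] by simp
  moreover have "SB ?p ?w ?Y = LC ?p ?w ?Y"
    using SB_self_derivative[OF extend_field, of ?p ?w] by simp
  ultimately have "(\<Sum>b\<in>Basis. (?w \<bullet> b) *\<^sub>R SB ?p ?w (?e b))
      = (\<Sum>b\<in>Basis. (?w \<bullet> b) *\<^sub>R LC ?p ?w (?e b))"
    by simp
  then show ?thesis by (simp add: induced_deriv_def Let_def c_def[symmetric])
qed


section \<open>Differentiation under the integral\<close>

text \<open>
  Here \<open>\<iota> s\<close> is the segment of integration, moved with velocity \<open>u\<close> by the parameter \<open>s\<close>.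
\<close>

lemma integral_along_has_derivative:
  fixes h :: "'p::euclidean_space \<Rightarrow> real" and \<iota> :: "real \<Rightarrow> real \<Rightarrow> 'p"
  assumes h: "smooth_on S h" and dom: "deriv_domain S"
    and I: "open I" "convex I" "s0 \<in> I"
    and im: "\<And>s t. s \<in> I \<Longrightarrow> t \<in> {a..b} \<Longrightarrow> \<iota> s t \<in> S"
    and der: "\<And>s t. ((\<lambda>s. \<iota> s t) has_derivative (\<lambda>r. r *\<^sub>R u)) (at s within I)"
    and cont: "continuous_on (I \<times> {a..b}) (\<lambda>(s, t). \<iota> s t)"
  shows "((\<lambda>s. integral {a..b} (\<lambda>t. h (\<iota> s t))) has_real_derivative
    integral {a..b} (\<lambda>t. ddir S u h (\<iota> s0 t))) (at s0)"
proof -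
  have "((\<lambda>s. integral (cbox a b) (\<lambda>t. h (\<iota> s t))) has_field_derivative
    integral (cbox a b) (\<lambda>t. ddir S u h (\<iota> s0 t))) (at s0 within I)"
  proof (rule leibniz_rule_field_derivative[OF _ _ _ I(3,2)])
    fix s t assume st: "s \<in> I" "t \<in> cbox a b"
    then have iS: "\<iota> s t \<in> S" using im by simp
    have "((\<lambda>s. h (\<iota> s t)) has_derivative (\<lambda>r. ddir S (r *\<^sub>R u) h (\<iota> s t))) (at s within I)"
      by (rule has_derivative_in_compose[OF der
        has_derivative_subset[OF smooth_on_has_derivative[OF h dom iS]]])
        (use im st in auto)
    moreover have "ddir S (r *\<^sub>R u) h (\<iota> s t) = r * ddir S u h (\<iota> s t)" for r
      using linear_cmul[OF has_derivative_linear[OF smooth_on_has_derivative[OF h dom iS]], of r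
        u] by simp
    ultimately show "((\<lambda>s. h (\<iota> s t)) has_field_derivative ddir S u h (\<iota> s t)) (at s within I)"
      by (simp add: has_field_derivative_def mult.commute[of _ "ddir S u h _"])
  next
    fix s assume s: "s \<in> I"
    have "continuous_on (cbox a b) (\<lambda>t. h (\<iota> s t))"
    proof (rule continuous_on_compose2[OF smooth_on_continuous[OF h]])
      have "continuous_on (cbox a b) (\<lambda>t. (\<lambda>(s, t). \<iota> s t) (s, t))"
        by (rule continuous_on_compose2[OF cont]) (use s in \<open>auto intro!: continuous_intros\<close>)
      then show "continuous_on (cbox a b) (\<iota> s)" by simp
    qed (use im s in auto)
    then show "(\<lambda>t. h (\<iota> s t)) integrable_on cbox a b" by (rule integrable_continuous)
  next
    have "continuous_on (I \<times> cbox a b) (\<lambda>z. ddir S u h ((\<lambda>(s, t). \<iota> s t) z))"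
      by (rule continuous_on_compose2[OF smooth_on_continuous[OF smooth_on_ddir[OF h dom]]])
        (use cont im in auto)
    then show "continuous_on (I \<times> cbox a b) (\<lambda>(s, t). ddir S u h (\<iota> s t))"
      by (simp add: case_prod_beta')
  qed
  then show ?thesis by (simp add: at_within_open[OF I(3,1)])
qed


section \<open>The second variation formula\<close>

theorem theorem1p1:
  fixes A :: "('m::{t2_space, second_countable_topology}, 'e::euclidean_space) chart set"
    and g :: "'m \<Rightarrow> 'e \<Rightarrow> 'e \<Rightarrow> real"
    and J :: "'m \<Rightarrow> 'e \<Rightarrow> 'e"
    and LC SB :: "('m, 'e) connection"
    and \<gamma> :: "real \<Rightarrow> 'm"
    and \<alpha> :: "real \<times> real \<times> real \<Rightarrow> 'm"
    and V W \<gamma>' DV DW :: "real \<Rightarrow> 'e"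
    and a b \<epsilon>1 \<epsilon>2 :: real
    and S :: "(real \<times> real \<times> real) set"
    and E :: "real \<Rightarrow> real \<Rightarrow> real"
    and index boundary :: "real \<Rightarrow> real"
  assumes "hermitian_manifold A g J"
    and "levi_civita A g LC"
    and "strominger_bismut A g J LC SB"
    and "a < b" and "0 < \<epsilon>1" and "0 < \<epsilon>2"
    and "geodesic A LC a b \<gamma>" and "unit_speed A g a b \<gamma>"
    and S_def: "S = {a..b} \<times> {-\<epsilon>1<..<\<epsilon>1} \<times> {-\<epsilon>2<..<\<epsilon>2}"
    and "smooth_map_on A S \<alpha>"
    and "\<forall>t\<in>{a..b}. \<alpha> (t, 0, 0) = \<gamma> t"
    and "\<forall>t\<in>{a..b}. pushforward A S \<alpha> (0, 1, 0) (t, 0, 0) = V t"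
    and "\<forall>t\<in>{a..b}. pushforward A S \<alpha> (0, 0, 1) (t, 0, 0) = W t"
    and \<gamma>'_def: "\<gamma>' = velocity A a b \<gamma>"
    and DV_def: "DV = induced_deriv A SB \<gamma> {a..b} 1 V"
    and DW_def: "DW = induced_deriv A SB \<gamma> {a..b} 1 W"
    and E_def: "E = (\<lambda>s1 s2. energy A g a b (\<lambda>t. \<alpha> (t, s1, s2)))"
    and index_def: "index = (\<lambda>t. g (\<gamma> t) (DV t) (DW t)
          + torsion_tensor A g SB (\<gamma> t) (V t) (\<gamma>' t) (DW t)
          - curvature_tensor A g SB (\<gamma> t) (V t) (\<gamma>' t) (\<gamma>' t) (W t))"
    and boundary_def: "boundary = (\<lambda>t.
          g (\<gamma> t) (induced_deriv A SB \<alpha> S (0, 1, 0) (pushforward A S \<alpha> (0, 0, 1)) (t, 0, 0)) (\<gamma>' t))"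
  shows "index integrable_on {a..b} \<and>
     has_mixed_partial E (integral {a..b} index + (boundary b - boundary a)) 0 0 \<and>
     ((\<forall>s1\<in>{-\<epsilon>1<..<\<epsilon>1}. \<forall>s2\<in>{-\<epsilon>2<..<\<epsilon>2}. \<alpha> (a, s1, s2) = \<gamma> a \<and> \<alpha> (b, s1, s2) = \<gamma> b) \<longrightarrow>
         has_mixed_partial E (integral {a..b} index) 0 0)"
proof -
  let ?I1 = "{-\<epsilon>1<..<\<epsilon>1}" and ?I2 = "{-\<epsilon>2<..<\<epsilon>2}"
  let ?t = "(1, 0, 0) :: real \<times> real \<times> real"
    and ?u = "(0, 1, 0) :: real \<times> real \<times> real" and ?v = "(0, 0, 1) :: real \<times> real \<times> real"
  have dom_t: "deriv_domain {a..b}" by (rule deriv_domain_Icc[OF \<open>a < b\<close>])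
  have dom: "deriv_domain S"
    unfolding S_def by (intro deriv_domain_Times dom_t deriv_domain_open open_greaterThanLessThan)
  interpret hermitian_param A g J LC SB S \<alpha>
    by unfold_locales (use assms dom in \<open>auto simp: hermitian_manifold_def\<close>)
  interpret LC: param_conn A LC S \<alpha> by unfold_locales
  note sp = smooth_along_pushforward

  have slice: "((\<lambda>t. (t, s, r)) has_derivative (\<lambda>h. (h, 0, 0))) (at t within T)" for s r t :: real
      and T
    by (auto intro!: derivative_eq_intros simp: zero_prod_def)
  have slice_in: "(\<lambda>t. (t, s, r)) ` {a..b} \<subseteq> S" if "s \<in> ?I1" "r \<in> ?I2" for s r
    using that by (auto simp: S_def)
  have vel: "velocity A a b (\<lambda>t. \<alpha> (t, s, r)) t = push ?t (t, s, r)"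
    if "s \<in> ?I1" "r \<in> ?I2" "t \<in> {a..b}" for s r t
    unfolding velocity_def by (rule
      pushforward_reparam[OF dom_t slice_in[OF that(1,2)] that(3) slice]) simp
  have in0: "(0::real) \<in> ?I1" "(0::real) \<in> ?I2" using assms by auto
  note base_in = slice_in[OF in0]
  have \<gamma>: "\<gamma> t = \<alpha> (t, 0, 0)" if "t \<in> {a..b}" for t using assms that by simp
  have \<gamma>': "\<gamma>' t = push ?t (t, 0, 0)" if "t \<in> {a..b}" for t
    unfolding \<gamma>'_def velocity_def by (rule pushforward_reparam[OF dom_t base_in that slice \<gamma>])
  have V: "V t = push ?u (t, 0, 0)" and W: "W t = push ?v (t, 0, 0)" if "t \<in> {a..b}" for t
    using assms that by auto
  have DV: "DV t = nab ?t (push ?u) (t, 0, 0)" if "t \<in> {a..b}" for t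
    unfolding DV_def by (rule SB.induced_reparam[OF dom_t base_in that slice \<gamma> sp V])
  have DW: "DW t = nab ?t (push ?v) (t, 0, 0)" if "t \<in> {a..b}" for t
    unfolding DW_def by (rule SB.induced_reparam[OF dom_t base_in that slice \<gamma> sp W])
  have geo: "nab ?t (push ?t) (t, 0, 0) = 0" if t: "t \<in> {a..b}" for t
  proof -
    have tS: "(t, 0, 0) \<in> S" using base_in t by blast
    have "induced_deriv A LC \<gamma> {a..b} 1 (velocity A a b \<gamma>) t = 0"
      using assms(7) t unfolding geodesic_def by blast
    moreover have "induced_deriv A LC \<gamma> {a..b} 1 (velocity A a b \<gamma>) t
        = LC.nab ?t (push ?t) (t, 0, 0)"
      by (rule LC.induced_reparam[OF dom_t base_in t slice \<gamma> sp \<gamma>'[unfolded \<gamma>'_def]])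
    ultimately show ?thesis using SB_LC_acceleration[OF tS] by simp
  qed

  define e where "e = (\<lambda>z. g (\<alpha> z) (push ?t z) (push ?t z))"
  define e2 where "e2 = (\<lambda>z. g (\<alpha> z) (nab ?t (push ?v) z) (push ?t z))"
  define \<beta> where "\<beta> = (\<lambda>z. g (\<alpha> z) (nab ?u (push ?v) z) (push ?t z))"
  have sm_e: "smooth_on S e" unfolding e_def by (rule smooth_on_metric[OF sp sp])
  have sm_e2: "smooth_on S e2" unfolding e2_def
    by (rule smooth_on_metric[OF SB.smooth_along_induced[OF sp] sp])
  have sm_\<beta>: "smooth_on S \<beta>" unfolding \<beta>_def
    by (rule smooth_on_metric[OF SB.smooth_along_induced[OF sp] sp])

  have E_eq: "E s r = 1/2 * integral {a..b} (\<lambda>t. e (t, s, r))" if "s \<in> ?I1" "r \<in> ?I2" for s r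
    unfolding E_def energy_def e_def
      by (intro arg_cong2[of _ _ _ _ "(*)"] refl integral_cong) (simp add: vel[OF that])

  \<comment> \<open>The first variation at every \<open>s\<close> near \<open>0\<close>, as needed to differentiate it once more.\<close>
  have E_s2: "(E s has_real_derivative integral {a..b} (\<lambda>t. e2 (t, s, 0))) (at 0)" if s: "s \<in> ?I1"
      for s
  proof -
    have "((\<lambda>r. integral {a..b} (\<lambda>t. e (t, s, r))) has_real_derivative
        integral {a..b} (\<lambda>t. ddir S ?v e (t, s, 0))) (at 0)"
      by (rule integral_along_has_derivative[OF sm_e dom _ _ in0(2)])
        (use s in \<open>auto simp: S_def case_prod_beta' intro!: derivative_eq_intros continuous_intros\<close>)
    also have "integral {a..b} (\<lambda>t. ddir S ?v e (t, s, 0)) = integral {a..b} (\<lambda>t. 2 * e2 (t, s, 0))"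
      using slice_in[OF s in0(2)] unfolding e_def e2_def
      by (intro integral_cong first_variation_integrand) blast
    finally have "((\<lambda>r. 1/2 * integral {a..b} (\<lambda>t. e (t, s, r))) has_real_derivative
        1/2 * (2 * integral {a..b} (\<lambda>t. e2 (t, s, 0)))) (at 0)"
      by (intro DERIV_cmult) simp
    then have "((\<lambda>r. 1/2 * integral {a..b} (\<lambda>t. e (t, s, r))) has_real_derivative
        integral {a..b} (\<lambda>t. e2 (t, s, 0))) (at 0)" by simp
    then show ?thesis
      by (rule has_field_derivative_transform_within_open[OF _ open_greaterThanLessThan in0(2)])
        (use E_eq[OF s] in simp)
  qed
  have E_s1s2: "((\<lambda>s. integral {a..b} (\<lambda>t. e2 (t, s, 0))) has_real_derivative
      integral {a..b} (\<lambda>t. ddir S ?u e2 (t, 0, 0))) (at 0)"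
    by (rule integral_along_has_derivative[OF sm_e2 dom _ _ in0(1)])
      (use in0 in \<open>auto simp: S_def case_prod_beta' intro!: derivative_eq_intros continuous_intros\<close>)
  have mixed: "has_mixed_partial E (integral {a..b} (\<lambda>t. ddir S ?u e2 (t, 0, 0))) 0 0"
    unfolding has_mixed_partial_def eventually_nhds
    using E_s1s2 E_s2 in0
    by (intro exI[of _ "\<lambda>s. integral {a..b} (\<lambda>t. e2 (t, s, 0))"]) (auto intro!: exI[of _ ?I1])

  \<comment> \<open>Integrability of \<open>index\<close> comes from this identity: the first term is continuous, the
      second is the derivative of \<open>\<beta>\<close> along \<open>\<gamma>\<close>.\<close>
  have index: "index t = ddir S ?u e2 (t, 0, 0) - ddir S ?t \<beta> (t, 0, 0)" if t: "t \<in> {a..b}" for t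
  proof -
    have tS: "(t, 0, 0) \<in> S" using base_in t by blast
    show ?thesis
      unfolding e2_def \<beta>_def second_variation_integrand[OF tS geo[OF t]] index_def
      by (simp add: \<gamma>[OF t] \<gamma>'[OF t] V[OF t] W[OF t] DV[OF t] DW[OF t])
  qed
  have boundary: "boundary t = \<beta> (t, 0, 0)" if "t \<in> {a..b}" for t
    unfolding boundary_def \<beta>_def \<gamma>[OF that] \<gamma>'[OF that] ..

  have "((\<lambda>t. ddir S ?t \<beta> (t, 0, 0)) has_integral \<beta> (b, 0, 0) - \<beta> (a, 0, 0)) {a..b}"
  proof (rule fundamental_theorem_of_calculus[where f = "\<lambda>t. \<beta> (t, 0, 0)"])
    fix t assume t: "t \<in> {a..b}"
    then have tS: "(t, 0, 0) \<in> S" using base_in by blast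
    note D = smooth_on_has_derivative[OF sm_\<beta> dom tS]
    have "((\<lambda>t. \<beta> (t, 0, 0)) has_derivative (\<lambda>h. ddir S (h, 0, 0) \<beta> (t, 0, 0)))
        (at t within {a..b})"
      by (rule has_derivative_in_compose[where g = \<beta> and f = "\<lambda>t. (t, 0, 0)",
            OF slice has_derivative_subset[OF D base_in]])
    moreover have "ddir S (h, 0, 0) \<beta> (t, 0, 0) = h *\<^sub>R ddir S ?t \<beta> (t, 0, 0)" for h
    proof -
      have "(h, 0, 0) = h *\<^sub>R ?t" by simp
      then show ?thesis by (simp only: linear_cmul[OF has_derivative_linear[OF D]])
    qed
    ultimately show "((\<lambda>t. \<beta> (t, 0, 0)) has_vector_derivative ddir S ?t \<beta> (t, 0, 0))
        (at t within {a..b})"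
      unfolding has_vector_derivative_def by (rule has_derivative_eq_rhs[OF _ ext])
  qed (use \<open>a < b\<close> in simp)
  then have int_\<beta>: "((\<lambda>t. ddir S ?t \<beta> (t, 0, 0)) has_integral boundary b - boundary a) {a..b}"
    using boundary \<open>a < b\<close> by simp
  have "continuous_on {a..b} (\<lambda>t. ddir S ?u e2 (t, 0, 0))"
    by (rule continuous_on_compose2[OF smooth_on_continuous[OF smooth_on_ddir[OF sm_e2 dom]] _
      base_in])
      (intro continuous_intros)
  then have "((\<lambda>t. ddir S ?u e2 (t, 0, 0)) has_integral integral {a..b}
      (\<lambda>t. ddir S ?u e2 (t, 0, 0))) {a..b}"
    using integrable_continuous_interval integrable_integral by blast
  from has_integral_diff[OF this int_\<beta>]
  have int_index: "(index has_integral integral {a..b} (\<lambda>t. ddir S ?u e2 (t, 0, 0))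
      - (boundary b - boundary a)) {a..b}"
    by (rule has_integral_eq[rotated]) (simp add: index)
  then have integrable: "index integrable_on {a..b}" and
    eq: "integral {a..b} (\<lambda>t. ddir S ?u e2 (t, 0, 0)) = integral {a..b} index
        + (boundary b - boundary a)"
    by (auto simp: has_integral_iff)

  \<comment> \<open>Where all curves of the variation pass through one point, the field \<open>\<alpha>\<^sub>* \<partial>/\<partial>s\<^sub>2\<close> vanishes
      along the transversal curve \<open>s \<mapsto> \<alpha> (t, s, 0)\<close>, hence so does its derivative along that
      curve.\<close>
  have fixed: "boundary t = 0"
    if t: "t \<in> {a..b}" and const: "\<And>s r. s \<in> ?I1 \<Longrightarrow> r \<in> ?I2 \<Longrightarrow> \<alpha> (t, s, r) = \<gamma> t" for t
  proof -
    have dom1: "deriv_domain ?I1" and dom2: "deriv_domain ?I2"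
      by (auto intro: deriv_domain_open)
    have W0: "push ?v (t, s, 0) = 0" if s: "s \<in> ?I1" for s
    proof -
      have "pushforward A ?I2 (\<lambda>r. \<gamma> t) 1 0 = push ?v (t, s, 0)"
        by (rule pushforward_reparam[OF dom2 _ in0(2), of "\<lambda>r. (t, s, r)" "\<lambda>r. (0, 0, r)"
          "\<lambda>r. \<gamma> t" 1])
          (use s t const in \<open>auto simp: S_def intro!: derivative_eq_intros\<close>)
      moreover have "pushforward A ?I2 (\<lambda>r. \<gamma> t) 1 0 = 0"
        using ddir_eq[OF has_derivative_const dom2 in0(2)] by (simp add: pushforward_def ddir_def)
      ultimately show ?thesis by simp
    qed
    have "induced_deriv A SB (\<lambda>s. \<alpha> (t, s, 0)) ?I1 1 (\<lambda>s. push ?v (t, s, 0)) 0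
        = nab ?u (push ?v) (t, 0, 0)"
      by (rule SB.induced_reparam[OF dom1 _ in0(1), of "\<lambda>s. (t, s, 0)" "\<lambda>s. (0, s, 0)"])
        (use t in0 sp in \<open>auto simp: S_def intro!: derivative_eq_intros\<close>)
    moreover have "induced_deriv A SB (\<lambda>s. \<alpha> (t, s, 0)) ?I1 1 (\<lambda>s. push ?v (t, s, 0)) 0 = 0"
    proof -
      let ?c = "chart_at A (\<alpha> (t, 0, 0))"
      have "ddir ?I1 1 (\<lambda>s. tcoord A ?c (\<alpha> (t, s, 0)) (push ?v (t, s, 0))) 0 = ddir ?I1 1 (\<lambda>s. 0) 0"
      proof (rule ddir_cong[OF _ in0(1)])
        fix s assume s: "s \<in> ?I1"
        have "\<alpha> (t, s, 0) = \<alpha> (t, 0, 0)" using const[OF s in0(2)] const[OF in0] by simp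
        then show "tcoord A ?c (\<alpha> (t, s, 0)) (push ?v (t, s, 0)) = 0"
          using W0[OF s] by simp
      qed
      also have "\<dots> = 0" by (rule ddir_eq[OF has_derivative_const dom1 in0(1)])
      finally show ?thesis
        using W0[OF in0(1)] by (simp add: induced_deriv_def Let_def ddir_def)
    qed
    ultimately show ?thesis by (simp add: boundary_def g_linear)
  qed
  show ?thesis
  proof (intro conjI impI)
    show "index integrable_on {a..b}" by (rule integrable)
    show "has_mixed_partial E (integral {a..b} index + (boundary b - boundary a)) 0 0"
      using mixed unfolding eq .
    assume "\<forall>s1\<in>?I1. \<forall>s2\<in>?I2. \<alpha> (a, s1, s2) = \<gamma> a \<and> \<alpha> (b, s1, s2) = \<gamma> b"
    then have "boundary a = 0" "boundary b = 0" using fixed \<open>a < b\<close> by auto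
    then show "has_mixed_partial E (integral {a..b} index) 0 0" using mixed eq by simp
  qed
qed

end
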